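(* Let $f:\mathbb{R}\to\mathbb{R}$ be $C^2$ and suppose the ODE $\dot{x}=f(x)$ has a hyperbolic attracting rest point at $x=a$ whose basin of attraction $D$ is the half-infinite interval $D=(-\infty,\beta)$, where $\beta>a$ is a finite number and $x=\beta$ is a hyperbolic unstable rest point of $\dot{x}=f(x)$. Let $-\mu<0$ equal the minimum value of $f$ on $[a,\beta]$. Fix a finite constant $\lambda_\infty>\beta-a$. Let $\Lambda$ be the set of functions $\lambda:\mathbb{R}\to\mathbb{R}$ satisfying all of the following conditions: $\lambda$ is globally Lipschitz continuous and monotone non-decreasing; $\lim_{t\to-\infty}\lambda(t)=0$ and $\lim_{t\to\infty}\lambda(t)=\lambda_\infty$; there exists $T$ such that $\lambda$ restricted to $(T,\infty)$ is $C^2$; and there exists a number $\rho>0$ such that $\lim_{t\to\infty}\frac{\ddot{\lambda}(t)}{e^{-\rho t}}$ exists (and is finite). Then there exists a number $m_c>\mu$ (depending on $f$, $a$, $\beta$ and $\lambda_\infty$, but not on $\lambda$) such that: (i) if $\lambda\in\Lambda$ induces tipping in the ODE $\dot{x}=f(x+\lambda(t))$, then $\dot{\lambda}(t)\ge m_c$ for at least one $t$; (ii) there exists $\lambda\in\Lambda$ which induces tipping in $\dot{x}=f(x+\lambda(t))$ and satisfies $\max_t\dot{\lambda}(t)=m_c$; (iii) viewed as a function of $\lambda_\infty\in(\beta-a,\infty)$, $m_c$ is continuous and strictly decreasing and satisfies $\lim_{\lambda_\infty\to\beta-a}m_c=\infty$ and $\lim_{\lambda_\infty\to\infty}m_c=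\mu$.
   Context: A globally Lipschitz $\lambda$ is differentiable almost everywhere with essentially bounded measurable derivative; $\dot{\lambda}(t)$ refers to points $t$ where $\lambda$ is differentiable, and "for at least one $t$" and "$\max_t$" range over such points. Solutions of $\dot{y}=f(y)+u(t)$ with $u$ measurable and essentially bounded are understood in the Carathéodory sense: (locally) absolutely continuous functions satisfying $y(t)=y(t_0)+\int_{t_0}^t \big(f(y(s))+u(s)\big)\,ds$, defined on their maximal interval of existence. Induces tipping: let $\hat{y}$ be the unique solution of $\dot{y}=f(y)+\dot{\lambda}(t)$ with $\lim_{t\to-\infty}\hat{y}(t)=a$ (equivalently, under the change of coordinates $y=x+\lambda$, $\hat{y}=\hat{x}+\lambda$, where $\hat{x}$ is the unique solution of $\dot{x}=f(x+\lambda(t))$ with $\lim_{t\to-\infty}\hat{x}(t)=a$). Then $\lambda$ induces tipping in $\dot{x}=f(x+\lambda(t))$ if and only if it is not the case that $\lim_{t\to\infty}\hat{y}(t)=a$. In particular, convergence $\lim_{t\to\infty}\hat{y}(t)\in\partial D$ and escape of $\hat{y}$ from $\overline{D}$ (including finite-time blow-up) both count as tipping. A rest point $p$ of $\dot{x}=f(x)$ is hyperbolic if $f'(p)\neq 0$. *)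

theory Defs
  imports "HOL-Analysis.Analysis"
begin

(* Used on open sets only: C1_differentiable_on takes derivatives in the full
   neighbourhood filter of each point of S. *)
definition C2_differentiable_on :: "(real \<Rightarrow> real) \<Rightarrow> real set \<Rightarrow> bool"
  where "C2_differentiable_on g S \<longleftrightarrow>
    g C1_differentiable_on S \<and> (deriv g) C1_differentiable_on S"

definition autonomous_solution :: "(real \<Rightarrow> real) \<Rightarrow> real set \<Rightarrow> (real \<Rightarrow> real) \<Rightarrow> bool"
  where "autonomous_solution f I x \<longleftrightarrow>
    (\<forall>t\<in>I. (x has_real_derivative f (x t)) (at t within I))"

definition basin :: "(real \<Rightarrow> real) \<Rightarrow> real \<Rightarrow> real set"
  where "basin f p =
    {x0. \<exists>x. autonomous_solution f {0..} x \<and> x 0 = x0 \<and> (x \<longlongrightarrow> p) at_top}"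

definition hyperbolic_rest_point :: "(real \<Rightarrow> real) \<Rightarrow> real \<Rightarrow> bool"
  where "hyperbolic_rest_point f p \<longleftrightarrow> f p = 0 \<and> deriv f p \<noteq> 0"

(* Lyapunov stability. Quantifying over solutions on compact intervals [0,T]
   covers every forward solution on its whole interval of existence. *)
definition stable_at :: "(real \<Rightarrow> real) \<Rightarrow> real \<Rightarrow> bool"
  where "stable_at f p \<longleftrightarrow>
    (\<forall>\<epsilon>>0. \<exists>\<delta>>0. \<forall>T\<ge>0. \<forall>x. autonomous_solution f {0..T} x \<and> \<bar>x 0 - p\<bar> < \<delta> \<longrightarrow>
       (\<forall>t\<in>{0..T}. \<bar>x t - p\<bar> < \<epsilon>))"

definition attracting_at :: "(real \<Rightarrow> real) \<Rightarrow> real \<Rightarrow> bool"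
  where "attracting_at f p \<longleftrightarrow> stable_at f p \<and> p \<in> interior (basin f p)"

(* Caratheodory solutions of y' = f(y) + u(t) on an interval I. Being an indefinite
   integral of a Lebesgue integrable function, y is automatically absolutely
   continuous on compact subintervals of I. Values of u on null sets are irrelevant. *)
definition caratheodory_solution ::
    "(real \<Rightarrow> real) \<Rightarrow> (real \<Rightarrow> real) \<Rightarrow> real set \<Rightarrow> (real \<Rightarrow> real) \<Rightarrow> bool"
  where "caratheodory_solution f u I y \<longleftrightarrow> is_interval I \<and>
    (\<forall>t0\<in>I. \<forall>t\<in>I. t0 \<le> t \<longrightarrow>
       (\<lambda>s. f (y s) + u s) absolutely_integrable_on {t0..t} \<and>
       y t = y t0 + integral {t0..t} (\<lambda>s. f (y s) + u s))"

definition maximal_solution ::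
    "(real \<Rightarrow> real) \<Rightarrow> (real \<Rightarrow> real) \<Rightarrow> real set \<Rightarrow> (real \<Rightarrow> real) \<Rightarrow> bool"
  where "maximal_solution f u I y \<longleftrightarrow> caratheodory_solution f u I y \<and>
    (\<forall>J z. caratheodory_solution f u J z \<and> I \<subseteq> J \<and> (\<forall>t\<in>I. z t = y t) \<longrightarrow> J = I)"

(* y, with maximal interval of existence I, is the solution of y' = f(y) + lam'(t) that
   tends to a as t tends to -\<infinity>. *)
definition pullback_solution ::
    "(real \<Rightarrow> real) \<Rightarrow> real \<Rightarrow> (real \<Rightarrow> real) \<Rightarrow> real set \<Rightarrow> (real \<Rightarrow> real) \<Rightarrow> bool"
  where "pullback_solution f a lam I y \<longleftrightarrow> maximal_solution f (deriv lam) I y \<and>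
    (\<exists>t0. {..t0} \<subseteq> I) \<and> (y \<longlongrightarrow> a) at_bot"

(* The pullback solution is unique on its interval of existence; its values off I are
   meaningless, hence the explicit condition that I contains a neighbourhood of \<infinity>. *)
definition induces_tipping :: "(real \<Rightarrow> real) \<Rightarrow> real \<Rightarrow> (real \<Rightarrow> real) \<Rightarrow> bool"
  where "induces_tipping f a lam \<longleftrightarrow>
    (\<exists>I y. pullback_solution f a lam I y \<and> \<not> ((\<exists>t0. {t0..} \<subseteq> I) \<and> (y \<longlongrightarrow> a) at_top))"

definition parameter_shifts :: "real \<Rightarrow> (real \<Rightarrow> real) set"
  where "parameter_shifts lam_inf = {lam.
    (\<exists>L. L-lipschitz_on UNIV lam) \<and> mono lam \<and>
    (lam \<longlongrightarrow> 0) at_bot \<and> (lam \<longlongrightarrow> lam_inf) at_top \<and>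
    (\<exists>T. C2_differentiable_on lam {T<..}) \<and>
    (\<exists>\<rho>>0. \<exists>c. ((\<lambda>t. deriv (deriv lam) t / exp (- \<rho> * t)) \<longlongrightarrow> c) at_top)}"

end

theory Submission
  imports Defs
begin

text \<open>
  The idea is an optimal use of a budget. The total shift \<open>c\<close> is the budget, and it
  is spent on pushing the solution \<open>y\<close> uphill from \<open>a\<close> to the threshold \<open>\<beta>\<close> against the drift
  \<open>f < 0\<close>. If the shift always moves at speed \<open>m\<close>, then \<open>y' = f y + m\<close>, the passage takes the time
  \<open>\<integral> dx / (f x + m)\<close> over \<open>[a, \<beta>]\<close>, and so costs the amount \<open>passage_shift m = \<integral> m dx / (f x + m)\<close>.
  Faster is cheaper: the integrand is \<open>1 / (1 + f x / m)\<close> with \<open>f x < 0\<close> and so decreases in \<open>m\<close>.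
  The critical rate is the speed at which the budget is just sufficient, that is, the inverse
  function of \<open>passage_shift\<close>. Its continuity, its monotonicity and its two limits are read
  off from those of \<open>passage_shift\<close>, which tends to \<open>\<beta> - a\<close> for fast shifts and to infinity as \<open>m\<close>
  decreases to \<open>\<mu>\<close>, because \<open>f + \<mu>\<close> vanishes to second order at the minimum of \<open>f\<close>.

  The ramp of slope \<open>m = critical_rate c\<close> and height \<open>c\<close> tips: its solution reaches \<open>\<beta>\<close> exactly when
  the ramp ends, and stays there (\<open>ramp_trajectory\<close>).

  Conversely let \<open>\<lambda>' < m\<close> wherever \<open>\<lambda>\<close> is differentiable, and let \<open>\<Phi>' = m / (f + m)\<close>. Then
  \<open>\<Phi>(y) - \<lambda>\<close> has derivative \<open>f(y) (m - \<lambda>') / (f(y) + m) \<le> 0\<close> almost everywhere while \<open>y\<close> is in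
  \<open>[a, \<beta>]\<close>, with strict inequality inside. So \<open>\<Phi>(y) - \<Phi>(a)\<close> never exceeds the amount of shift spent,
  whereas getting from \<open>a\<close> to \<open>\<beta>\<close> needs \<open>\<Phi>(\<beta>) - \<Phi>(a) = c\<close>, the whole budget (\<open>y_less_\<beta>\<close>). Being
  trapped in \<open>[a, \<beta>)\<close>, the solution is global (\<open>global_if_maximal\<close>). The function \<open>x = y - \<lambda>\<close> has
  derivative \<open>f(y) \<le> 0\<close>, so it converges, and \<open>y\<close> tends to a zero of \<open>f\<close>; the limit \<open>\<beta>\<close> is excluded by
  the same budget argument, which leaves \<open>a\<close> (\<open>converges_to_a\<close>).

  The shift is only Lipschitz, and its derivative enters the equation under an integral. All the above
  rests on two facts about a Lipschitz function of a real variable: it is differentiable almost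
  everywhere (\<open>Lipschitz_differentiable_ae\<close>), and it is the integral of its derivative
  (\<open>Lipschitz_has_integral_deriv\<close>). Both are derived from Vitali's covering theorem. They turn the
  Caratheodory equation for \<open>y\<close> into \<open>x' = f(x + \<lambda>)\<close>, an equation with continuous right-hand side.
\<close>

section \<open>Lipschitz functions are integrals of their derivatives\<close>

text \<open>
  An interval is the ball about its midpoint, so Vitali's theorem applies to intervals that contain
  the point \<open>x\<close> anywhere. The predicate \<open>P\<close> selects the intervals of interest, and those
  that are short enough lie in \<open>U\<close>.
\<close>

lemma Vitali_cover_intervals:
  fixes E U :: "real set"
  assumes "open U" "E \<subseteq> U"
    and fine: "\<And>x e. x \<in> E \<Longrightarrow> e > 0 \<Longrightarrow> \<exists>u v. u \<le> x \<and> x \<le> v \<and> u < v \<and> v - u < e \<and> P u v"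
  obtains C where "countable C" "\<And>u v. (u,v) \<in> C \<Longrightarrow> u < v \<and> P u v \<and> {u..v} \<subseteq> U"
    "disjoint_family_on (\<lambda>(u,v). {u..v}) C" "negligible (E - (\<Union>(u,v)\<in>C. {u..v}))"
proof -
  define K where "K = {(u,v). u < v \<and> P u v \<and> {u..v} \<subseteq> U}"
  define ctr rad where "ctr = (\<lambda>(u,v). (u + v) / 2 :: real)" and "rad = (\<lambda>(u,v). (v - u) / 2 :: real)"
  have cball: "cball (ctr i) (rad i) = (case i of (u,v) \<Rightarrow> {u..v})" for i
    by (cases i) (auto simp: ctr_def rad_def cball_eq_atLeastAtMost field_simps)
  obtain C where C: "countable C" "C \<subseteq> K"
    "pairwise (\<lambda>i j. disjnt (cball (ctr i) (rad i)) (cball (ctr j) (rad j))) C"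
    "negligible (E - (\<Union>i\<in>C. cball (ctr i) (rad i)))"
  proof (rule Vitali_covering_theorem_cballs)
    show "0 < rad i" if "i \<in> K" for i
      using that by (auto simp: K_def rad_def)
    show "\<exists>i. i \<in> K \<and> x \<in> cball (ctr i) (rad i) \<and> rad i < d" if "x \<in> E" "0 < d" for x d
    proof -
      obtain e where e: "e > 0" "ball x e \<subseteq> U"
        using assms(1,2) \<open>x \<in> E\<close> openE by blast
      obtain u v where uv: "u \<le> x" "x \<le> v" "u < v" "v - u < min d e" "P u v"
        using fine[OF \<open>x \<in> E\<close>, of "min d e"] e \<open>0 < d\<close> by auto
      have "{u..v} \<subseteq> ball x e"
        using uv by (auto simp: dist_real_def)
      then show ?thesis
        using uv e by (intro exI[of _ "(u,v)"] conjI) (auto simp: K_def cball, auto simp: rad_def)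
    qed
  qed
  show thesis
  proof (rule that[OF C(1)])
    show "u < v \<and> P u v \<and> {u..v} \<subseteq> U" if "(u,v) \<in> C" for u v
      using that C(2) by (auto simp: K_def)
    show "disjoint_family_on (\<lambda>(u,v). {u..v}) C"
      using C(3) by (auto simp: disjoint_family_on_def pairwise_def disjnt_def cball)
    show "negligible (E - (\<Union>(u,v)\<in>C. {u..v}))"
      using C(4) by (simp add: cball)
  qed
qed

text \<open>
  The intervals of a Vitali cover are disjoint and lie in \<open>U\<close>, so inequalities between measures of single
  intervals add up to an inequality between the measures of \<open>E\<close> and \<open>U\<close>. Two measures \<open>\<mu>\<close> will be
  used: the Stieltjes measure of a monotone function, and Lebesgue measure itself.
\<close>

lemma emeasure_le_of_interval_bounds:
  fixes E U :: "real set" and \<mu> :: "real measure"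
  assumes "open U" "E \<subseteq> U" "E \<in> sets borel" "sets \<mu> = sets borel"
    and bound: "\<And>u v. u < v \<Longrightarrow> P u v \<Longrightarrow> k * emeasure lborel (E \<inter> {u..v}) \<le> emeasure \<mu> {u..v}"
    and fine: "\<And>x e. x \<in> E \<Longrightarrow> e > 0 \<Longrightarrow> \<exists>u v. u \<le> x \<and> x \<le> v \<and> u < v \<and> v - u < e \<and> P u v"
  shows "k * emeasure lborel E \<le> emeasure \<mu> U"
proof -
  obtain C where C: "countable C" "\<And>u v. (u,v) \<in> C \<Longrightarrow> u < v \<and> P u v \<and> {u..v} \<subseteq> U"
    "disjoint_family_on (\<lambda>(u,v). {u..v}) C" "negligible (E - (\<Union>(u,v)\<in>C. {u..v}))"
    using Vitali_cover_intervals[OF assms(1,2) fine] by blast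
  define X where "X = (\<lambda>(u,v). {u..v::real})"
  have X: "X i \<in> sets borel" for i by (auto simp: X_def split: prod.split)
  have UX: "(\<Union>i\<in>C. X i) \<in> sets borel"
    using X C(1) by (intro sets.countable_UN') auto
  have null: "emeasure lborel (E - (\<Union>i\<in>C. X i)) = 0"
  proof -
    have "emeasure lebesgue (E - (\<Union>i\<in>C. X i)) = 0"
      using C(4) by (simp add: negligible_iff_null_sets X_def null_sets_def)
    then show ?thesis
      using UX assms(3) by simp
  qed
  have dis: "disjoint_family_on X C" using C(3) by (simp add: X_def)
  then have dis': "disjoint_family_on (\<lambda>i. E \<inter> X i) C" 
    unfolding disjoint_family_on_def by blast
  have "emeasure lborel E \<le> emeasure lborel ((\<Union>i\<in>C. E \<inter> X i) \<union> (E - (\<Union>i\<in>C. X i)))"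
    using UX assms(3) X by (intro emeasure_mono sets.Un sets.countable_UN' sets.Diff) (auto intro: C(1))
  also have "\<dots> \<le> emeasure lborel (\<Union>i\<in>C. E \<inter> X i) + 0"
    unfolding null[symmetric]
    using UX assms(3) X by (intro emeasure_subadditive sets.Un sets.countable_UN' sets.Diff) (auto intro: C(1))
  also have "\<dots> = (\<integral>\<^sup>+i. emeasure lborel (E \<inter> X i) \<partial>count_space C)"
    using C(1) dis' X assms(3) by (subst emeasure_UN_countable) auto
  finally have "k * emeasure lborel E \<le> k * (\<integral>\<^sup>+i. emeasure lborel (E \<inter> X i) \<partial>count_space C)"
    by (rule mult_left_mono) simp
  also have "\<dots> = (\<integral>\<^sup>+i. k * emeasure lborel (E \<inter> X i) \<partial>count_space C)"
    by (simp add: nn_integral_cmult)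
  also have "\<dots> \<le> (\<integral>\<^sup>+i. emeasure \<mu> (X i) \<partial>count_space C)"
    using C(2) bound by (intro nn_integral_mono) (auto simp: X_def)
  also have "\<dots> = emeasure \<mu> (\<Union>i\<in>C. X i)"
    using C(1) dis X assms(4) by (subst emeasure_UN_countable) auto
  also have "\<dots> \<le> emeasure \<mu> U"
    using C(2) assms(1,4) by (intro emeasure_mono) (auto simp: X_def)
  finally show ?thesis .
qed

text \<open>
  If \<open>F\<close> grows at least at the rate \<open>r\<close> along arbitrarily short intervals around each point of \<open>E\<close>, then
  it gains at least \<open>r\<close> times the measure of \<open>E\<close>. Intervals on which \<open>F\<close> grows more slowly do not
  spoil this, since \<open>F\<close> never decreases.
\<close>

lemma measure_le_increment:
  fixes F :: "real \<Rightarrow> real" and E :: "real set"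
  assumes F: "mono F" "continuous_on UNIV F" and E: "E \<in> sets borel" "E \<subseteq> {c<..<d}"
    and "c \<le> d" "r \<ge> 0"
    and fine: "\<And>x e. x \<in> E \<Longrightarrow> e > 0 \<Longrightarrow> \<exists>u v. u \<le> x \<and> x \<le> v \<and> u < v \<and> v - u < e \<and> r * (v - u) \<le> F v - F u"
  shows "r * measure lborel E \<le> F d - F c"
proof -
  have I: "emeasure (interval_measure F) {u..v} = F v - F u" if "u \<le> v" for u v
    using F that by (intro emeasure_interval_measure_Icc) (auto dest: monoD)
  have fin: "emeasure lborel E \<le> ennreal (d - c)"
    using emeasure_mono[OF E(2), of lborel] \<open>c \<le> d\<close> by simp
  have fin': "emeasure lborel E \<noteq> \<infinity>"
    using fin by (metis ennreal_neq_top infinity_ennreal_def neq_top_trans)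
  have "ennreal r * emeasure lborel E \<le> emeasure (interval_measure F) {c<..<d}"
  proof (rule emeasure_le_of_interval_bounds[where P = "\<lambda>u v. r * (v - u) \<le> F v - F u"])
    fix u v :: real assume uv: "u < v" "r * (v - u) \<le> F v - F u"
    have "ennreal r * emeasure lborel (E \<inter> {u..v}) \<le> ennreal r * emeasure lborel {u..v}"
      by (intro mult_left_mono emeasure_mono) auto
    also have "\<dots> = ennreal (r * (v - u))"
      using uv \<open>r \<ge> 0\<close> by (simp add: ennreal_mult)
    also have "\<dots> \<le> ennreal (F v - F u)"
      using uv by (intro ennreal_leI)
    finally show "ennreal r * emeasure lborel (E \<inter> {u..v}) \<le> emeasure (interval_measure F) {u..v}"
      using I uv by simp
  qed (use E fine in auto)
  also have "\<dots> \<le> emeasure (interval_measure F) {c..d}"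
    by (intro emeasure_mono) auto
  also have "\<dots> = ennreal (F d - F c)" using I \<open>c \<le> d\<close> by simp
  finally have "ennreal (r * measure lborel E) \<le> ennreal (F d - F c)"
    using \<open>r \<ge> 0\<close> fin' by (simp add: emeasure_eq_ennreal_measure ennreal_mult)
  then show ?thesis
    using monoD[OF F(1) \<open>c \<le> d\<close>] by (subst (asm) ennreal_le_iff) auto
qed

text \<open>
  A weak form of Lebesgue's density theorem. Choose an open \<open>U\<close> around \<open>E\<close> whose excess measure is less
  than \<open>e\<close>. Summing the density bound over a Vitali cover inside \<open>U\<close> gives
  \<open>k * |E| \<le> |U| \<le> |E| + e\<close>, which for all \<open>e\<close> forces \<open>|E| = 0\<close>.
\<close>

lemma null_if_density_bounded_below_1:
  fixes E :: "real set"
  assumes E: "E \<in> sets borel" "bounded E" and "k > 1"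
    and dens: "\<And>c d. c < d \<Longrightarrow> k * measure lborel (E \<inter> {c<..<d}) \<le> d - c"
  shows "E \<in> null_sets lborel"
proof -
  have E': "E \<in> sets lebesgue" using E(1) by simp
  have fin: "emeasure lborel E < \<infinity>"
    using emeasure_bounded_finite[OF E(2)] .
  have "k * measure lborel E \<le> measure lborel E + e" if "e > 0" for e :: real
  proof -
    obtain U where U: "open U" "E \<subseteq> U" "U - E \<in> lmeasurable" "emeasure lebesgue (U - E) < ennreal e"
      using sets_lebesgue_outer_open[OF E' \<open>e > 0\<close>] by blast
    have "ennreal k * emeasure lborel E \<le> emeasure lborel U"
    proof (rule emeasure_le_of_interval_bounds[where P = "\<lambda>_ _. True"])
      fix u v :: real assume uv: "u < v"
      have fin1: "emeasure lborel (E \<inter> {u<..<v}) \<noteq> \<infinity>"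
        by (rule less_imp_neq[OF emeasure_bounded_finite[OF bounded_Int[OF disjI1[OF E(2)]]]])
      have "emeasure lborel (E \<inter> {u..v}) \<le> emeasure lborel ((E \<inter> {u<..<v}) \<union> {u,v})"
        using E by (intro emeasure_mono) auto
      also have "\<dots> \<le> emeasure lborel (E \<inter> {u<..<v}) + emeasure lborel {u,v}"
        using E by (intro emeasure_subadditive) auto
      also have "emeasure lborel {u,v} = 0"
        by (rule emeasure_lborel_countable) simp
      finally have "emeasure lborel (E \<inter> {u..v}) \<le> emeasure lborel (E \<inter> {u<..<v})"
        by (simp only: add_0_right)
      then have "ennreal k * emeasure lborel (E \<inter> {u..v}) \<le> ennreal k * emeasure lborel (E \<inter> {u<..<v})"
        by (rule mult_left_mono) simp
      also have "\<dots> = ennreal (k * measure lborel (E \<inter> {u<..<v}))"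
        using \<open>k > 1\<close> fin1 by (simp add: emeasure_eq_ennreal_measure ennreal_mult)
      also have "\<dots> \<le> ennreal (v - u)"
        by (rule ennreal_leI[OF dens[OF uv]])
      finally show "ennreal k * emeasure lborel (E \<inter> {u..v}) \<le> emeasure lborel {u..v}"
        using uv by simp
    next
      show "\<exists>u v. u \<le> x \<and> x \<le> v \<and> u < v \<and> v - u < e \<and> True" if "e > 0" for x e :: real
        using that by (intro exI[of _ x] exI[of _ "x + e/2"]) auto
    qed (use U E in auto)
    also have "\<dots> \<le> emeasure lborel E + emeasure lborel (U - E)"
      using U(2) by (subst Un_absorb1[OF U(2), symmetric], subst Un_Diff_cancel[symmetric],
           intro emeasure_subadditive) (use E U in auto)
    also have "\<dots> \<le> emeasure lborel E + ennreal e"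
      using U E by (intro add_left_mono) auto
    finally have "ennreal (k * measure lborel E) \<le> ennreal (measure lborel E + e)"
      using \<open>k > 1\<close> fin that by (simp add: emeasure_eq_ennreal_measure ennreal_mult ennreal_plus)
    then show ?thesis
      using that by (subst (asm) ennreal_le_iff) (auto intro: add_nonneg_nonneg)
  qed
  then have "k * measure lborel E \<le> measure lborel E"
    by (rule field_le_epsilon)
  then have "(k - 1) * measure lborel E \<le> 0" by (simp add: algebra_simps)
  then have "measure lborel E = 0"
    using \<open>k > 1\<close> measure_nonneg[of lborel E] by (auto simp: mult_le_0_iff)
  then show ?thesis
    using fin E by (auto simp: null_sets_def emeasure_eq_ennreal_measure)
qed

definition diff_quotient :: "(real \<Rightarrow> real) \<Rightarrow> real \<Rightarrow> real \<Rightarrow> real"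
  where "diff_quotient F x h = (F (x + h) - F x) / h"

text \<open>
  At a point of this set the difference quotient is below \<open>p\<close> for some arbitrarily small steps, and above
  \<open>q\<close> for others.
  For continuous \<open>F\<close> the strict inequalities make the set a countable intersection of open sets.
\<close>

definition oscillation_set :: "(real \<Rightarrow> real) \<Rightarrow> real \<Rightarrow> real \<Rightarrow> real set"
  where "oscillation_set F p q =
    {x. (\<forall>e>0. \<exists>h. h \<noteq> 0 \<and> \<bar>h\<bar> < e \<and> diff_quotient F x h < p) \<and>
        (\<forall>e>0. \<exists>h. h \<noteq> 0 \<and> \<bar>h\<bar> < e \<and> q < diff_quotient F x h)}"

lemma Lipschitz_diff_quotient_bound:
  assumes "K-lipschitz_on UNIV F" 
  shows "\<bar>diff_quotient F x h\<bar> \<le> K"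
proof (cases "h = 0")
  case False
  have "\<bar>F (x + h) - F x\<bar> \<le> K * \<bar>h\<bar>"
    using lipschitz_onD[OF assms, of "x + h" x] by (simp add: dist_real_def)
  then show ?thesis
    using False by (simp add: diff_quotient_def abs_divide field_simps)
qed (use lipschitz_on_nonneg[OF assms] in \<open>simp add: diff_quotient_def\<close>)

lemma oscillation_set_borel:
  assumes "continuous_on UNIV F"
  shows "oscillation_set F p q \<in> sets borel"
proof -
  have op: "open {x. diff_quotient F x h < p}" "open {x. q < diff_quotient F x h}" if "h \<noteq> 0" for h p q
    unfolding diff_quotient_def
    using that assms by (auto intro!: open_Collect_less continuous_intros
         intro: continuous_on_compose2[OF assms])
  have small: "(\<forall>e>0. \<exists>h. h \<noteq> 0 \<and> \<bar>h\<bar> < e \<and> R h) \<longleftrightarrow> (\<forall>n. \<exists>h. h \<noteq> 0 \<and> \<bar>h\<bar> < inverse (Suc n) \<and> R h)"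
    for R :: "real \<Rightarrow> bool"
  proof
    assume *: "\<forall>n. \<exists>h. h \<noteq> 0 \<and> \<bar>h\<bar> < inverse (Suc n) \<and> R h"
    show "\<forall>e>0. \<exists>h. h \<noteq> 0 \<and> \<bar>h\<bar> < e \<and> R h"
    proof safe
      fix e :: real assume "e > 0"
      then obtain n where "inverse (real (Suc n)) < e" using reals_Archimedean by blast
      with * show "\<exists>h. h \<noteq> 0 \<and> \<bar>h\<bar> < e \<and> R h" by (meson less_trans)
    qed
  qed auto
  have "oscillation_set F p q =
     (\<Inter>n. \<Union>h\<in>{h. h \<noteq> 0 \<and> \<bar>h\<bar> < inverse (Suc n)}. {x. diff_quotient F x h < p}) \<inter>
     (\<Inter>n. \<Union>h\<in>{h. h \<noteq> 0 \<and> \<bar>h\<bar> < inverse (Suc n)}. {x. q < diff_quotient F x h})"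
    unfolding oscillation_set_def small by auto
  also have "\<dots> \<in> sets borel"
    by (intro sets.Int sets.countable_INT' borel_open open_UN ballI) (use op in \<open>auto intro!: borel_open open_UN\<close>)
  finally show ?thesis .
qed

text \<open>
  Both \<open>F x + K x\<close> and \<open>K x - F x\<close> are nondecreasing, and they add up to \<open>2 K x\<close>. At the points of \<open>E\<close> the
  first grows at the rate \<open>K + q\<close> and the second at the rate \<open>K - p\<close> along suitable short intervals, so by
  \<open>measure_le_increment\<close> their increments over \<open>[c, d]\<close> are at least \<open>(K + q) |E|\<close> and \<open>(K - p) |E|\<close>.
  If \<open>p < q\<close>, the sum of the two rates exceeds \<open>2 K\<close>, hence \<open>E\<close> cannot fill any interval.
\<close>

lemma oscillation_set_measure_le:
  fixes F :: "real \<Rightarrow> real"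
  assumes F: "K-lipschitz_on UNIV F" and "p < q" "c < d"
    and E: "E \<subseteq> oscillation_set F p q" "E \<in> sets borel" "E \<subseteq> {c<..<d}"
  shows "(2 * K + q - p) * measure lborel E \<le> 2 * K * (d - c)"
proof (cases "E = {}")
  case False
  note Q = Lipschitz_diff_quotient_bound[OF F]
  have K: "K \<ge> 0" using lipschitz_on_nonneg[OF F] .
  obtain x0 where x0: "x0 \<in> oscillation_set F p q" using False E by auto
  have lo: "- K < p" and hi: "q < K"
  proof -
    obtain h1 where "diff_quotient F x0 h1 < p"
      using x0 zero_less_one unfolding oscillation_set_def by blast
    with abs_le_D2[OF Q[of x0 h1]] show "- K < p" by linarith
    obtain h2 where "q < diff_quotient F x0 h2"
      using x0 zero_less_one unfolding oscillation_set_def by blast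
    with abs_le_D1[OF Q[of x0 h2]] show "q < K" by linarith
  qed
  have inc: "\<bar>F v - F u\<bar> \<le> K * (v - u)" if "u \<le> v" for u v
    using lipschitz_onD[OF F, of v u] that by (simp add: dist_real_def)
  have cont: "continuous_on UNIV F" using lipschitz_on_continuous_on[OF F] .
  have up: "(K + q) * measure lborel E \<le> (F d + K * d) - (F c + K * c)"
  proof (rule measure_le_increment[where F = "\<lambda>x. F x + K * x"])
    show "mono (\<lambda>x. F x + K * x)"
    proof
      fix u v :: real assume "u \<le> v"
      from inc[OF this] show "F u + K * u \<le> F v + K * v" by (simp add: abs_le_iff algebra_simps)
    qed
    fix x e :: real assume "x \<in> E" "e > 0"
    then obtain h where h: "h \<noteq> 0" "\<bar>h\<bar> < e" "q < diff_quotient F x h"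
      using E(1) unfolding oscillation_set_def by blast
    show "\<exists>u v. u \<le> x \<and> x \<le> v \<and> u < v \<and> v - u < e \<and> (K + q) * (v - u) \<le> (F v + K * v) - (F u + K * u)"
    proof (cases "h > 0")
      case True
      then have "q * h < F (x + h) - F x" using h by (simp add: diff_quotient_def pos_less_divide_eq pos_divide_less_eq)
      then show ?thesis using h True
        by (intro exI[of _ x] exI[of _ "x + h"] conjI) (simp_all add: algebra_simps)
    next
      case False
      with h have "h < 0" by simp
      then have "F (x + h) - F x < q * h" using h by (simp add: diff_quotient_def neg_less_divide_eq neg_divide_less_eq)
      then show ?thesis using h \<open>h < 0\<close>
        by (intro exI[of _ "x + h"] exI[of _ x] conjI) (simp_all add: algebra_simps)
    qed
  qed (use E \<open>c < d\<close> lo hi \<open>p < q\<close> in \<open>auto intro!: continuous_intros cont\<close>)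
  have down: "(K - p) * measure lborel E \<le> (K * d - F d) - (K * c - F c)"
  proof (rule measure_le_increment[where F = "\<lambda>x. K * x - F x"])
    show "mono (\<lambda>x. K * x - F x)"
    proof
      fix u v :: real assume "u \<le> v"
      from inc[OF this] show "K * u - F u \<le> K * v - F v" by (simp add: abs_le_iff algebra_simps)
    qed
    fix x e :: real assume "x \<in> E" "e > 0"
    then obtain h where h: "h \<noteq> 0" "\<bar>h\<bar> < e" "diff_quotient F x h < p"
      using E(1) unfolding oscillation_set_def by blast
    show "\<exists>u v. u \<le> x \<and> x \<le> v \<and> u < v \<and> v - u < e \<and> (K - p) * (v - u) \<le> (K * v - F v) - (K * u - F u)"
    proof (cases "h > 0")
      case True
      then have "F (x + h) - F x < p * h" using h by (simp add: diff_quotient_def pos_less_divide_eq pos_divide_less_eq)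
      then show ?thesis using h True
        by (intro exI[of _ x] exI[of _ "x + h"] conjI) (simp_all add: algebra_simps)
    next
      case False
      with h have "h < 0" by simp
      then have "p * h < F (x + h) - F x" using h by (simp add: diff_quotient_def neg_less_divide_eq neg_divide_less_eq)
      then show ?thesis using h \<open>h < 0\<close>
        by (intro exI[of _ "x + h"] exI[of _ x] conjI) (simp_all add: algebra_simps)
    qed
  qed (use E \<open>c < d\<close> lo hi \<open>p < q\<close> in \<open>auto intro!: continuous_intros cont\<close>)
  from up down show ?thesis by (simp add: algebra_simps)
qed (use lipschitz_on_nonneg[OF F] \<open>c < d\<close> in auto)

lemma oscillation_set_negligible:
  fixes F :: "real \<Rightarrow> real"
  assumes F: "K-lipschitz_on UNIV F" and "p < q"
  shows "negligible (oscillation_set F p q)"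
proof -
  \<comment> \<open>The constant is enlarged so that it is positive and can be divided by.\<close>
  have F1: "(K+1)-lipschitz_on UNIV F" using lipschitz_on_le[OF F] by simp
  have K: "K + 1 > 0" using lipschitz_on_nonneg[OF F] by simp
  let ?O = "oscillation_set F p q"
  have O: "?O \<in> sets borel"
    by (rule oscillation_set_borel[OF lipschitz_on_continuous_on[OF F]])
  have "negligible (?O \<inter> {- real n<..<real n})" for n
  proof -
    let ?E = "?O \<inter> {- real n<..<real n}"
    have E: "?E \<in> sets borel" using O by simp
    have "?E \<in> null_sets lborel"
    proof (rule null_if_density_bounded_below_1[OF E])
      show "bounded ?E" using bounded_box by (simp add: bounded_Int)
      show "1 < (2 * (K + 1) + q - p) / (2 * (K + 1))"
        using \<open>p < q\<close> K by (simp add: field_simps)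
      show "(2 * (K + 1) + q - p) / (2 * (K + 1)) * measure lborel (?E \<inter> {c<..<d}) \<le> d - c" if "c < d" for c d
      proof -
        have "(2 * (K + 1) + q - p) * measure lborel (?E \<inter> {c<..<d}) \<le> 2 * (K + 1) * (d - c)"
          by (rule oscillation_set_measure_le[OF F1 \<open>p < q\<close> that]) (use E in auto)
        then show ?thesis using K by (simp add: field_simps)
      qed
    qed
    then show ?thesis
      using null_sets_completionI negligible_iff_null_sets by blast
  qed
  then have "negligible (\<Union>n. ?O \<inter> {- real n<..<real n})" by (rule negligible_Union_nat)
  moreover have "?O \<subseteq> (\<Union>n. ?O \<inter> {- real n<..<real n})"
  proof
    fix x assume x: "x \<in> ?O"
    obtain n where "\<bar>x\<bar> < real n" using reals_Archimedean2 by blast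
    with x have "x \<in> ?O \<inter> {- real n<..<real n}" by auto
    then show "x \<in> (\<Union>n. ?O \<inter> {- real n<..<real n})" by blast
  qed
  ultimately show ?thesis using negligible_subset by blast
qed

text \<open>
  The difference quotients are bounded by \<open>K\<close>, so their lower and upper limits at \<open>0\<close> are finite. If they
  agree, they are the derivative; otherwise two rationals fit strictly between them.
\<close>

lemma not_differentiable_oscillates:
  fixes F :: "real \<Rightarrow> real"
  assumes F: "K-lipschitz_on UNIV F" and nd: "\<not> F differentiable (at x)"
  shows "\<exists>p q::rat. p < q \<and> x \<in> oscillation_set F (of_rat p) (of_rat q)"
proof -
  let ?Q = "\<lambda>h. ereal (diff_quotient F x h)"
  note Q = Lipschitz_diff_quotient_bound[OF F, of x]
  define l u where "l = Liminf (at 0) ?Q" and "u = Limsup (at 0) ?Q"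
  have "l \<le> u" unfolding l_def u_def by (rule Liminf_le_Limsup) simp
  have bl: "ereal (-K) \<le> l" unfolding l_def
    by (rule Liminf_bounded) (simp add: abs_le_D2[OF Q, THEN minus_le_iff[THEN iffD1]])
  have bu: "u \<le> ereal K" unfolding u_def
    by (rule Limsup_bounded) (simp add: abs_le_D1[OF Q])
  have "l \<noteq> u"
  proof
    assume "l = u"
    moreover obtain D where "l = ereal D" using bl bu \<open>l \<le> u\<close> by (cases l) auto
    ultimately have "(?Q \<longlongrightarrow> ereal D) (at 0)"
      unfolding l_def u_def by (intro Liminf_eq_Limsup) auto
    then have "(diff_quotient F x \<longlongrightarrow> D) (at 0)" by simp
    then have "DERIV F x :> D" by (simp add: DERIV_def diff_quotient_def[abs_def])
    with nd show False using real_differentiable_def by blast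
  qed
  with \<open>l \<le> u\<close> have "l < u" by simp
  then obtain q where q: "l < ereal (real_of_rat q)" "ereal (real_of_rat q) < u" using ereal_dense3 by blast
  obtain p where p: "l < ereal (real_of_rat p)" "ereal (real_of_rat p) < ereal (real_of_rat q)"
    using ereal_dense3[OF q(1)] by blast
  have 1: "\<exists>h. h \<noteq> 0 \<and> \<bar>h\<bar> < e \<and> diff_quotient F x h < of_rat p" if "e > 0" for e
  proof (rule ccontr)
    assume "\<not> ?thesis"
    then have "eventually (\<lambda>h. ereal (of_rat p) \<le> ?Q h) (at 0)"
      using that by (auto simp: eventually_at not_less intro!: exI[of _ e])
    from Liminf_bounded[OF this] p(1) show False by (simp add: l_def)
  qed
  have 2: "\<exists>h. h \<noteq> 0 \<and> \<bar>h\<bar> < e \<and> of_rat q < diff_quotient F x h" if "e > 0" for e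
  proof (rule ccontr)
    assume "\<not> ?thesis"
    then have "eventually (\<lambda>h. ?Q h \<le> ereal (of_rat q)) (at 0)"
      using that by (auto simp: eventually_at not_less intro!: exI[of _ e])
    from Limsup_bounded[OF this] q(2) show False by (simp add: u_def)
  qed
  have "p < q" using p(2) by (simp add: of_rat_less)
  then show ?thesis using 1 2 unfolding oscillation_set_def by blast
qed

theorem Lipschitz_differentiable_ae:
  fixes F :: "real \<Rightarrow> real"
  assumes F: "K-lipschitz_on UNIV F"
  shows "negligible {x. \<not> F differentiable (at x)}"
proof (rule negligible_subset)
  let ?I = "{(p::rat, q). p < q}"
  show "negligible (\<Union>(p, q)\<in>?I. oscillation_set F (of_rat p) (of_rat q))"
  proof (rule negligible_countable_Union)
    show "countable ((\<lambda>(p, q). oscillation_set F (real_of_rat p) (real_of_rat q)) ` ?I)"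
      by (intro countable_image countableI_type)
    show "negligible t" if "t \<in> (\<lambda>(p, q). oscillation_set F (real_of_rat p) (real_of_rat q)) ` ?I" for t
      using that by (auto intro: oscillation_set_negligible[OF F] simp: of_rat_less)
  qed
  show "{x. \<not> F differentiable (at x)} \<subseteq> (\<Union>(p, q)\<in>?I. oscillation_set F (of_rat p) (of_rat q))"
    using not_differentiable_oscillates[OF F] by fastforce
qed

lemma Lipschitz_abs_deriv_le:
  fixes F :: "real \<Rightarrow> real"
  assumes F: "K-lipschitz_on UNIV F" and "F differentiable (at x)"
  shows "\<bar>deriv F x\<bar> \<le> K"
proof -
  have "DERIV F x :> deriv F x"
    using assms(2) by (simp add: DERIV_deriv_iff_real_differentiable)
  then have "((\<lambda>h. \<bar>diff_quotient F x h\<bar>) \<longlongrightarrow> \<bar>deriv F x\<bar>) (at 0)"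
    by (intro tendsto_rabs) (simp add: DERIV_def diff_quotient_def[abs_def])
  then show ?thesis
    by (rule tendsto_upperbound) (use Lipschitz_diff_quotient_bound[OF F] in auto)
qed

text \<open>
  The integral of the difference quotient with step \<open>h\<close> over \<open>[c, d]\<close> telescopes to the mean of \<open>F\<close> over
  \<open>[d, d + h]\<close> minus the mean over \<open>[c, c + h]\<close>. As \<open>h\<close> tends to \<open>0\<close> the means tend to \<open>F d\<close> and \<open>F c\<close>,
  and the integrals tend to that of the derivative by dominated convergence with bound \<open>K\<close>.
\<close>

theorem Lipschitz_has_integral_deriv:
  fixes F :: "real \<Rightarrow> real"
  assumes F: "K-lipschitz_on UNIV F" and "c \<le> d"
  shows "(deriv F has_integral F d - F c) {c..d}"
proof -
  define N where "N = {x. \<not> F differentiable (at x)}"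
  have N: "negligible N" using Lipschitz_differentiable_ae[OF F] by (simp add: N_def)
  have cont: "continuous_on S F" for S
    using lipschitz_on_continuous_on[OF F] continuous_on_subset by blast
  have int: "F integrable_on {u..v}" for u v
    using integrable_continuous_real[OF cont] .
  define A where "A = (\<lambda>t. integral {c..t} F)"
  define h where "h n = inverse (real (Suc n))" for n
  have h: "h n > 0" "h n \<noteq> 0" for n by (auto simp: h_def)
  have h0: "h \<longlonglongrightarrow> 0" unfolding h_def using LIMSEQ_inverse_real_of_nat .
  have avg: "(\<lambda>n. integral {t..t + h n} F / h n) \<longlonglongrightarrow> F t" for t
  proof -
    have "((\<lambda>s. integral {t..s} F) has_vector_derivative F t) (at t within {t..t+1})"
      by (rule integral_has_vector_derivative) (use cont in auto)
    then have "((\<lambda>s. integral {t..s} F) has_field_derivative F t) (at t within {t..t+1})"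
      by (simp add: has_real_derivative_iff_has_vector_derivative)
    then have lim: "((\<lambda>s. integral {t..s} F / (s - t)) \<longlongrightarrow> F t) (at t within {t..t+1})"
      by (simp add: has_field_derivative_iff)
    have "(\<lambda>n. t + h n) \<longlonglongrightarrow> t" using tendsto_add[OF tendsto_const h0] by simp
    moreover have "t + h n \<in> {t..t+1} - {t}" for n
      using h by (auto simp: h_def field_simps)
    ultimately have "filterlim (\<lambda>n. t + h n) (at t within {t..t+1}) sequentially"
      unfolding filterlim_at by auto
    from filterlim_compose[OF lim this] show ?thesis by simp
  qed
  have quot: "((\<lambda>x. diff_quotient F x (h n)) has_integral
      integral {d..d + h n} F / h n - integral {c..c + h n} F / h n) {c..d}" for n
  proof -
    have shift: "((\<lambda>x. F (x + h n)) has_integral integral {c + h n..d + h n} F) {c..d}"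
      using has_integral_affinity[of F "integral {c + h n..d + h n} F" "c + h n" "d + h n" 1 "h n"] int
      by (simp add: image_affinity_atLeastAtMost_diff has_integral_integral)
    have "integral {c..c + h n} F + integral {c + h n..d + h n} F = integral {c..d + h n} F"
         "integral {c..d} F + integral {d..d + h n} F = integral {c..d + h n} F"
      using \<open>c \<le> d\<close> h(1)[of n] by (auto intro!: Henstock_Kurzweil_Integration.integral_combine int)
    then have "integral {c + h n..d + h n} F - integral {c..d} F = integral {d..d + h n} F - integral {c..c + h n} F"
      by simp
    with has_integral_diff[OF shift integrable_integral[OF int]]
    have "((\<lambda>x. F (x + h n) - F x) has_integral integral {d..d + h n} F - integral {c..c + h n} F) {c..d}"
      by simp
    from has_integral_divide[OF this, of "h n"] show ?thesis
      by (simp add: diff_quotient_def diff_divide_distrib)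
  qed
  have "((\<lambda>x. if x \<in> N then 0 else deriv F x) has_integral F d - F c) {c..d}"
  proof (rule has_integral_dominated_convergence)
    show "((\<lambda>x. if x \<in> N then 0 else diff_quotient F x (h n)) has_integral
      integral {d..d + h n} F / h n - integral {c..c + h n} F / h n) {c..d}" for n
      by (rule has_integral_spike[OF N _ quot]) auto
    show "(\<lambda>_. K) integrable_on {c..d}" by (rule integrable_const_ivl)
    show "\<forall>x\<in>{c..d}. norm (if x \<in> N then 0 else diff_quotient F x (h n)) \<le> K" for n
      using Lipschitz_diff_quotient_bound[OF F] lipschitz_on_nonneg[OF F] by auto
    show "\<forall>x\<in>{c..d}. (\<lambda>n. if x \<in> N then 0 else diff_quotient F x (h n)) \<longlonglongrightarrow> (if x \<in> N then 0 else deriv F x)"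
    proof
      fix x
      have "(\<lambda>n. diff_quotient F x (h n)) \<longlonglongrightarrow> deriv F x" if "x \<notin> N"
      proof -
        have "DERIV F x :> deriv F x"
          using that by (simp add: N_def DERIV_deriv_iff_real_differentiable)
        then have "(diff_quotient F x \<longlongrightarrow> deriv F x) (at 0)"
          by (simp add: DERIV_def diff_quotient_def[abs_def])
        moreover have "filterlim h (at 0) sequentially"
          by (intro filterlim_atI h0) (simp add: h)
        ultimately show ?thesis by (rule filterlim_compose)
      qed
      then show "(\<lambda>n. if x \<in> N then 0 else diff_quotient F x (h n)) \<longlonglongrightarrow> (if x \<in> N then 0 else deriv F x)"
        by simp
    qed
    show "(\<lambda>n. integral {d..d + h n} F / h n - integral {c..c + h n} F / h n) \<longlonglongrightarrow> F d - F c"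
      by (intro tendsto_diff avg)
  qed
  then show ?thesis
    by (rule has_integral_spike[OF N, rotated]) auto
qed

section \<open>The sign of a vector field on a basin of attraction\<close>

lemma C1_imp_locally_Lipschitz:
  fixes f :: "real \<Rightarrow> real"
  assumes "f C1_differentiable_on UNIV"
  shows "\<exists>K. K-lipschitz_on {c..d} f"
proof -
  obtain D where D: "\<And>x. (f has_vector_derivative D x) (at x)" "continuous_on UNIV D"
    using assms by (auto simp: C1_differentiable_on_def)
  have "compact (D ` {c..d})"
    using D(2) by (intro compact_continuous_image continuous_on_subset[OF D(2)]) auto
  then obtain B where B: "B > 0" "\<And>x. x \<in> {c..d} \<Longrightarrow> norm (D x) \<le> B"
    using compact_imp_bounded[of "D ` {c..d}"] by (auto simp: bounded_pos)
  have "norm (f x - f y) \<le> B * norm (x - y)" if "x \<in> {c..d}" "y \<in> {c..d}" for x y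
    by (rule field_differentiable_bound[where S = "{c..d}" and f' = D])
       (use D(1) B that in \<open>auto intro: has_vector_derivative_at_within simp: has_real_derivative_iff_has_vector_derivative\<close>)
  then show ?thesis
    using B by (intro exI[of _ B] lipschitz_onI) (auto simp: dist_norm)
qed

text \<open>
  At an interior minimum \<open>f'\<close> vanishes, and \<open>f'\<close> is Lipschitz on \<open>[a, b]\<close>, hence at most \<open>K |x - p|\<close>
  between \<open>p\<close> and \<open>x\<close>; the mean value theorem supplies the second factor \<open>|x - p|\<close>.
\<close>

lemma C2_imp_quadratic_bound_at_minimum:
  fixes f :: "real \<Rightarrow> real"
  assumes f: "C2_differentiable_on f UNIV" and p: "a < p" "p < b"
    and min: "\<And>x. x \<in> {a..b} \<Longrightarrow> f p \<le> f x"
  shows "\<exists>C>0. \<forall>x\<in>{a..b}. f x - f p \<le> C * (x - p)\<^sup>2"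
proof -
  obtain K where K: "K-lipschitz_on {a..b} (deriv f)"
    using C1_imp_locally_Lipschitz f unfolding C2_differentiable_on_def by blast
  have D: "DERIV f x :> deriv f x" for x
    using f unfolding C2_differentiable_on_def
    by (metis C1_differentiable_on_eq UNIV_I DERIV_deriv_iff_real_differentiable)
  have "deriv f p = 0"
  proof (rule DERIV_local_min[OF D])
    show "0 < min (p - a) (b - p)" using p by auto
    show "\<forall>y. \<bar>p - y\<bar> < min (p - a) (b - p) \<longrightarrow> f p \<le> f y" 
    proof (intro allI impI)
      fix y assume "\<bar>p - y\<bar> < min (p - a) (b - p)"
      then have "y \<in> {a..b}" by (auto simp: abs_less_iff)
      then show "f p \<le> f y" by (rule min)
    qed
  qed
  have K0: "K \<ge> 0" using K lipschitz_on_nonneg by blast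
  have "f x - f p \<le> K * (x - p)\<^sup>2" if x: "x \<in> {a..b}" for x
  proof -
    have "norm (f x - f p) \<le> (K * \<bar>x - p\<bar>) * norm (x - p)"
    proof (rule field_differentiable_bound[where S = "closed_segment p x" and f' = "deriv f"])
      fix z assume z: "z \<in> closed_segment p x"
      show "(f has_field_derivative deriv f z) (at z within closed_segment p x)"
        by (rule has_field_derivative_at_within[OF D])
      have z': "z \<in> {a..b}" "\<bar>z - p\<bar> \<le> \<bar>x - p\<bar>" 
        using z x p by (auto simp: closed_segment_eq_real_ivl split: if_splits)
      have "\<bar>deriv f z - deriv f p\<bar> \<le> K * \<bar>z - p\<bar>"
        using lipschitz_onD[OF K z'(1), of p] p by (simp add: dist_real_def)
      also have "\<dots> \<le> K * \<bar>x - p\<bar>" using z'(2) K0 by (rule mult_left_mono)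
      finally show "norm (deriv f z) \<le> K * \<bar>x - p\<bar>" using \<open>deriv f p = 0\<close> by simp
    qed auto
    then have "f x - f p \<le> K * (\<bar>x - p\<bar> * \<bar>x - p\<bar>)" by (simp add: algebra_simps)
    then show ?thesis by (simp add: power2_eq_square)
  qed
  \<comment> \<open>The statement asks for a positive constant, whereas the Lipschitz constant may be zero.\<close>
  then have "\<forall>x\<in>{a..b}. f x - f p \<le> (K + 1) * (x - p)\<^sup>2"
    by (metis (no_types, lifting) add_increasing2 distrib_right mult_1 zero_le_power2)
  then show ?thesis using K0 by (intro exI[of _ "K + 1"]) auto
qed

text \<open>
  Uniqueness for the constant solution, by Gronwall's argument: the weighted squared distance
  \<open>exp (- 2 K t) (x t - x 0)^2\<close> starts at zero and cannot increase when \<open>K\<close> is a Lipschitz constant of \<open>f\<close> on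
  an interval that contains the values of \<open>x\<close> up to time \<open>T\<close>.
\<close>

lemma autonomous_solution_at_rest_point:
  fixes f :: "real \<Rightarrow> real"
  assumes lip: "\<And>c d. \<exists>K. K-lipschitz_on {c..d} f"
    and x: "autonomous_solution f {0..} x" and "f (x 0) = 0" and "T \<ge> 0"
  shows "x T = x 0"
proof -
  define p where "p = x 0"
  have D: "(x has_real_derivative f (x t)) (at t within {0..})" if "t \<ge> 0" for t
    using x that by (auto simp: autonomous_solution_def)
  have D': "(x has_real_derivative f (x t)) (at t)" if "t > 0" for t
  proof -
    have "at t within {0..} = at t" using that by (intro at_within_interior) (simp add: interior_Ici)
    then show ?thesis using D[of t] that by simp
  qed
  have cont: "continuous_on {0..T} x"
    by (rule DERIV_continuous_on[where D = "\<lambda>t. f (x t)"]) (auto intro: DERIV_subset[OF D])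
  have "bounded (x ` {0..T})"
    by (intro compact_imp_bounded compact_continuous_image cont) auto
  then obtain R where R: "\<And>t. t \<in> {0..T} \<Longrightarrow> \<bar>x t\<bar> \<le> R"
    unfolding bounded_iff by (metis imageI real_norm_def)
  obtain K where K: "K-lipschitz_on {-R..R} f" using lip by blast
  have est: "(x t - p) * f (x t) \<le> K * (x t - p)\<^sup>2" if "t \<in> {0..T}" for t
  proof -
    have "x t \<in> {-R..R}" "p \<in> {-R..R}"
      using R[OF that] R[of 0] \<open>T \<ge> 0\<close> by (auto simp: p_def abs_le_iff)
    from lipschitz_onD[OF K this] have "\<bar>f (x t)\<bar> \<le> K * \<bar>x t - p\<bar>"
      using assms(3) by (simp add: dist_real_def p_def)
    then have "\<bar>x t - p\<bar> * \<bar>f (x t)\<bar> \<le> \<bar>x t - p\<bar> * (K * \<bar>x t - p\<bar>)"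
      by (rule mult_left_mono) simp
    then have "\<bar>(x t - p) * f (x t)\<bar> \<le> K * (\<bar>x t - p\<bar> * \<bar>x t - p\<bar>)"
      by (simp only: abs_mult mult.left_commute)
    then show ?thesis by (simp add: power2_eq_square)
  qed
  define w where "w = (\<lambda>t. exp (- 2 * K * t) * (x t - p)\<^sup>2)"
  have "w T \<le> w 0"
  proof (rule DERIV_nonpos_imp_decreasing_open[OF \<open>T \<ge> 0\<close>])
    show "continuous_on {0..T} w"
      unfolding w_def by (intro continuous_intros cont)
    fix t assume t: "0 < t" "t < T"
    have "(w has_real_derivative 2 * exp (- 2 * K * t) * ((x t - p) * f (x t) - K * (x t - p)\<^sup>2)) (at t)"
      unfolding w_def by (rule derivative_eq_intros D'[OF t(1)] refl)+ (simp add: algebra_simps power2_eq_square)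
    moreover have "2 * exp (- 2 * K * t) * ((x t - p) * f (x t) - K * (x t - p)\<^sup>2) \<le> 0"
      using est[of t] t by (intro mult_nonneg_nonpos) auto
    ultimately show "\<exists>y. (w has_real_derivative y) (at t) \<and> y \<le> 0" by blast
  qed
  then have "(x T - p)\<^sup>2 \<le> 0" by (simp add: w_def p_def mult_le_0_iff)
  then show ?thesis by (simp add: p_def)
qed

text \<open>
  On its basin, the vector field points towards the attractor. The factor \<open>s\<close>, of which only the sign
  matters, treats both sides of \<open>p\<close> at once. Consider the last time \<open>\<tau>\<close> at which the solution from \<open>x0\<close> has
  not left \<open>x0\<close> in the direction of \<open>p\<close>. It is then at \<open>x0\<close> and afterwards strictly on the side of \<open>p\<close>, so its
  velocity \<open>f x0\<close> does not point away from \<open>p\<close>. Nor is it zero, by the preceding lemma.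
\<close>

lemma sign_on_basin:
  fixes f :: "real \<Rightarrow> real"
  assumes lip: "\<And>c d. \<exists>K. K-lipschitz_on {c..d} f"
    and "x0 \<in> basin f p" and s: "s * (p - x0) > 0"
  shows "s * f x0 > 0"
proof -
  obtain x where x: "autonomous_solution f {0..} x" "x 0 = x0" "(x \<longlongrightarrow> p) at_top"
    using assms(2) by (auto simp: basin_def)
  have D: "(x has_real_derivative f (x t)) (at t within {0..})" if "t \<ge> 0" for t
    using x that by (auto simp: autonomous_solution_def)
  have cont: "continuous_on {0..} x"
    by (rule DERIV_continuous_on[where D = "\<lambda>t. f (x t)"]) (auto intro: D)
  have ne: "f x0 \<noteq> 0"
  proof
    assume "f x0 = 0"
    then have "x t = x0" if "t \<ge> 0" for t
      using autonomous_solution_at_rest_point[OF lip x(1) _ that] x(2) by simp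
    then have "eventually (\<lambda>t. x t = x0) at_top"
      by (auto intro: eventually_mono[OF eventually_ge_at_top[of 0]])
    then have "(x \<longlongrightarrow> x0) at_top" by (rule tendsto_eventually)
    with x(3) have "x0 = p" using tendsto_unique trivial_limit_at_top_linorder by blast
    with s show False by simp
  qed
  have "((\<lambda>t. s * (x t - x0)) \<longlongrightarrow> s * (p - x0)) at_top"
    by (intro tendsto_intros x(3))
  from order_tendstoD(1)[OF this s] obtain T where T: "\<And>t. t \<ge> T \<Longrightarrow> s * (x t - x0) > 0"
    by (auto simp: eventually_at_top_linorder)
  define A where "A = {t \<in> {0..}. s * (x t - x0) \<le> 0}"
  define \<tau> where "\<tau> = Sup A"
  have A0: "0 \<in> A" using x(2) by (simp add: A_def)
  have bdd: "bdd_above A"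
  proof (rule bdd_aboveI)
    show "t \<le> T" if "t \<in> A" for t
      using T[of t] that by (cases "t \<ge> T") (auto simp: A_def)
  qed
  have "closed A"
    unfolding A_def by (intro continuous_closed_preimage_constant closed_Collect_le continuous_on_closed_Collect_le cont continuous_intros)
  then have tauA: "\<tau> \<in> A"
    using closed_contains_Sup A0 bdd unfolding \<tau>_def by blast
  then have tau0: "\<tau> \<ge> 0" by (simp add: A_def)
  have after: "s * (x t - x0) > 0" if "t > \<tau>" for t
  proof (rule ccontr)
    assume "\<not> ?thesis"
    then have "t \<in> A" using that tau0 by (simp add: A_def)
    then show False using cSup_upper[OF _ bdd] that unfolding \<tau>_def by fastforce
  qed
  have Dr: "(x has_real_derivative f (x \<tau>)) (at_right \<tau>)"
    by (rule DERIV_subset[OF D[OF tau0]]) (use tau0 in auto)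
  then have "(x \<longlongrightarrow> x \<tau>) (at_right \<tau>)"
    using DERIV_continuous continuous_within by blast
  then have "((\<lambda>t. s * (x t - x0)) \<longlongrightarrow> s * (x \<tau> - x0)) (at_right \<tau>)"
    by (intro tendsto_intros)
  moreover have "eventually (\<lambda>t. 0 \<le> s * (x t - x0)) (at_right \<tau>)"
    using after by (auto simp: eventually_at_filter less_imp_le)
  ultimately have "0 \<le> s * (x \<tau> - x0)" 
    by (rule tendsto_lowerbound) simp
  moreover have "s * (x \<tau> - x0) \<le> 0" using tauA by (simp add: A_def)
  ultimately have "x \<tau> = x0" using s by (auto simp: mult_le_0_iff zero_le_mult_iff)
  with Dr have "((\<lambda>t. s * ((x t - x0) / (t - \<tau>))) \<longlongrightarrow> s * f x0) (at_right \<tau>)"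
    by (intro tendsto_intros) (simp add: has_field_derivative_iff)
  moreover have "eventually (\<lambda>t. 0 \<le> s * ((x t - x0) / (t - \<tau>))) (at_right \<tau>)"
  proof -
    have "0 \<le> s * ((x t - x0) / (t - \<tau>))" if "t > \<tau>" for t
      using after[OF that] that by (simp add: field_simps)
    then show ?thesis by (auto simp: eventually_at_filter)
  qed
  ultimately have "0 \<le> s * f x0" by (rule tendsto_lowerbound) simp
  moreover have "s * f x0 \<noteq> 0" using ne s by auto
  ultimately show ?thesis by linarith
qed

section \<open>The critical rate\<close>

text \<open>
  The properties of \<open>f\<close> that the argument works with. The quadratic bound at a minimum point is what makes
  the passage time blow up as the speed decreases to \<open>\<mu>\<close>.
\<close>

locale potential_well =
  fixes f :: "real \<Rightarrow> real" and a \<beta> \<mu> :: real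
  assumes lip: "\<And>c d. \<exists>K. K-lipschitz_on {c..d} f"
    and a_less: "a < \<beta>" and f_a: "f a = 0" and f_\<beta>: "f \<beta> = 0"
    and f_neg: "\<And>x. a < x \<Longrightarrow> x < \<beta> \<Longrightarrow> f x < 0" and f_pos: "\<And>x. x < a \<Longrightarrow> f x > 0"
    and \<mu>_pos: "\<mu> > 0" and f_ge: "\<And>x. x \<in> {a..\<beta>} \<Longrightarrow> - \<mu> \<le> f x"
    and quadratic: "\<exists>p\<in>{a<..<\<beta>}. \<exists>C>0. \<forall>x\<in>{a..\<beta>}. f x + \<mu> \<le> C * (x - p)\<^sup>2"
begin

text \<open>
  The speed \<open>m\<close> times the time that \<open>y' = f y + m\<close> needs to go from \<open>a\<close> to \<open>\<beta>\<close>, that is, the distance that a shift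
  of constant speed \<open>m\<close> travels meanwhile.
\<close>

definition passage_shift :: "real \<Rightarrow> real"
  where "passage_shift m = integral {a..\<beta>} (\<lambda>x. m / (f x + m))"

definition critical_rate :: "real \<Rightarrow> real"
  where "critical_rate c = (THE m. \<mu> < m \<and> passage_shift m = c)"

lemma f_cont: "continuous_on S f"
proof -
  have "isCont f x" for x
  proof -
    obtain K where "K-lipschitz_on {x-1..x+1} f" using lip by blast
    then have "continuous_on {x-1..x+1} f" by (rule lipschitz_on_continuous_on)
    then show ?thesis by (rule continuous_on_interior) (simp add: interior_atLeastAtMost_real)
  qed
  then show ?thesis by (simp add: continuous_at_imp_continuous_on)
qed

lemma f_nonpos: "x \<in> {a..\<beta>} \<Longrightarrow> f x \<le> 0"
  using f_neg[of x] f_a f_\<beta> by (cases "x = a \<or> x = \<beta>") auto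

lemma denom_pos: "\<mu> < m \<Longrightarrow> x \<in> {a..\<beta>} \<Longrightarrow> 0 < f x + m"
  using f_ge[of x] by simp

lemma integrand_cont:
  assumes "\<mu> < m" shows "continuous_on {a..\<beta>} (\<lambda>x. m / (f x + m))"
  using denom_pos[OF assms] by (intro continuous_intros f_cont) fastforce

lemma integrand_int:
  assumes "\<mu> < m" "a \<le> c" "d \<le> \<beta>" shows "(\<lambda>x. m / (f x + m)) integrable_on {c..d}"
  using assms(2,3) by (intro integrable_continuous_real continuous_on_subset[OF integrand_cont[OF assms(1)]]) auto

lemma passage_shift_gt:
  assumes "\<mu> < m" shows "\<beta> - a < passage_shift m"
proof -
  have "integral {a..\<beta>} (\<lambda>x. 1) < integral {a..\<beta>} (\<lambda>x. m / (f x + m))"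
  proof (rule integral_less_real)
    show "continuous_on {a..\<beta>} (\<lambda>x. m / (f x + m))" by (rule integrand_cont[OF assms])
    show "{a<..<\<beta>} \<noteq> {}" using a_less by simp
    show "1 < m / (f x + m)" if "x \<in> {a<..<\<beta>}" for x
      using that f_neg[of x] denom_pos[OF assms, of x] by (simp add: less_divide_eq)
  qed simp
  then show ?thesis using a_less by (simp add: passage_shift_def)
qed

lemma passage_shift_strict_antimono:
  assumes "\<mu> < m" "m < n" shows "passage_shift n < passage_shift m"
  unfolding passage_shift_def
proof (rule integral_less_real)
  show "continuous_on {a..\<beta>} (\<lambda>x. m / (f x + m))" "continuous_on {a..\<beta>} (\<lambda>x. n / (f x + n))"
    using assms by (auto intro: integrand_cont)
  show "{a<..<\<beta>} \<noteq> {}" using a_less by simp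
  fix x assume x: "x \<in> {a<..<\<beta>}"
  then have pos: "0 < f x + m" "0 < f x + n" using assms denom_pos by auto
  have "f x * n < f x * m"
    using x f_neg[of x] assms by (intro mult_strict_left_mono_neg) auto
  then show "n / (f x + n) < m / (f x + m)"
    using pos by (simp add: divide_less_eq less_divide_eq algebra_simps)
qed

lemma passage_shift_le:
  assumes "\<mu> < m" shows "passage_shift m \<le> (\<beta> - a) * (m / (m - \<mu>))"
proof -
  have "passage_shift m \<le> integral {a..\<beta>} (\<lambda>x. m / (m - \<mu>))"
    unfolding passage_shift_def
  proof (rule integral_le[OF integrand_int[OF assms]])
    show "m / (f x + m) \<le> m / (m - \<mu>)" if "x \<in> {a..\<beta>}" for x
      using that assms \<mu>_pos f_ge[OF that] by (intro divide_left_mono) auto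
  qed auto
  then show ?thesis using a_less by simp
qed

text \<open>
  For \<open>m = \<mu> + \<delta>^2\<close> the denominator \<open>f x + m\<close> is at most \<open>(C + 1) \<delta>^2\<close> on an interval of length \<open>\<delta>\<close> next to the
  minimum point \<open>p\<close>. That interval alone contributes at least \<open>\<mu> / ((C + 1) \<delta>)\<close> to the integral.
\<close>

lemma passage_shift_unbounded: "\<exists>m>\<mu>. K < passage_shift m"
proof -
  obtain p C where p: "a < p" "p < \<beta>" and C: "C > 0" "\<And>x. x \<in> {a..\<beta>} \<Longrightarrow> f x + \<mu> \<le> C * (x - p)\<^sup>2"
    using quadratic by auto
  \<comment> \<open>The first bound keeps the interval inside the well, the second makes its contribution exceed the given bound.\<close>
  define \<delta> where "\<delta> = min (\<beta> - p) (\<mu> / ((C + 1) * (\<bar>K\<bar> + 1)))"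
  have \<delta>: "\<delta> > 0" "p + \<delta> \<le> \<beta>" using p C(1) \<mu>_pos by (auto simp: \<delta>_def min_le_iff_disj le_diff_eq[symmetric] add.commute[of p] intro!: mult_pos_pos divide_pos_pos)
  have "\<delta> \<le> \<mu> / ((C + 1) * (\<bar>K\<bar> + 1))" by (simp add: \<delta>_def)
  then have \<delta>K: "(\<bar>K\<bar> + 1) * ((C + 1) * \<delta>) \<le> \<mu>"
    using C(1) by (simp add: le_divide_eq mult_ac)
  define m where "m = \<mu> + \<delta>\<^sup>2"
  have m: "\<mu> < m" using \<delta> by (simp add: m_def)
  have "\<delta> * ((\<bar>K\<bar> + 1) / \<delta>) \<le> integral {p..p+\<delta>} (\<lambda>x. m / (f x + m))"
  proof -
    have "integral {p..p+\<delta>} (\<lambda>x. (\<bar>K\<bar> + 1) / \<delta>) \<le> integral {p..p+\<delta>} (\<lambda>x. m / (f x + m))"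
    proof (rule integral_le)
      show "(\<lambda>x. m / (f x + m)) integrable_on {p..p+\<delta>}"
        using p \<delta> by (intro integrand_int m) auto
      fix x assume x: "x \<in> {p..p+\<delta>}"
      then have x': "x \<in> {a..\<beta>}" using p \<delta> by auto
      have sq: "(x - p)\<^sup>2 \<le> \<delta>\<^sup>2" using x by (intro power_mono) auto
      have "f x + m \<le> C * (x - p)\<^sup>2 + \<delta>\<^sup>2" using C(2)[OF x'] by (simp add: m_def)
      also have "\<dots> \<le> (C + 1) * \<delta>\<^sup>2" using mult_left_mono[OF sq, of C] C(1) by (simp add: algebra_simps)
      finally have den: "f x + m \<le> (C + 1) * \<delta>\<^sup>2" .
      have "(\<bar>K\<bar> + 1) * (f x + m) \<le> (\<bar>K\<bar> + 1) * ((C + 1) * \<delta>\<^sup>2)"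
        using den by (intro mult_left_mono) auto
      also have "\<dots> = (\<bar>K\<bar> + 1) * ((C + 1) * \<delta>) * \<delta>" by (simp add: power2_eq_square)
      also have "\<dots> \<le> \<mu> * \<delta>" using \<delta>K \<delta>(1) by (intro mult_right_mono) auto
      also have "\<dots> \<le> m * \<delta>" using m \<delta>(1) by (intro mult_right_mono) auto
      finally show "(\<bar>K\<bar> + 1) / \<delta> \<le> m / (f x + m)"
        using denom_pos[OF m x'] \<delta>(1) by (simp add: divide_le_eq le_divide_eq mult_ac)
    qed auto
    then show ?thesis using \<delta> by simp
  qed
  also have "\<dots> \<le> passage_shift m"
    unfolding passage_shift_def
  proof (rule integral_subset_le)
    show "\<forall>x\<in>{a..\<beta>}. 0 \<le> m / (f x + m)"
      using denom_pos[OF m] m \<mu>_pos by (auto intro!: divide_nonneg_pos)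
  qed (use p \<delta> in \<open>auto intro!: integrand_int m\<close>)
  finally have "\<bar>K\<bar> + 1 \<le> passage_shift m" using \<delta>(1) by simp
  then show ?thesis using m by (intro exI[of _ m]) auto
qed

lemma passage_shift_cont: "continuous_on {\<mu><..} passage_shift"
proof -
  have "continuous_on ({\<mu><..} \<times> cbox a \<beta>) (\<lambda>(m, x). m / (f x + m))"
    unfolding split_beta
    using denom_pos by (intro continuous_intros continuous_on_compose2[OF f_cont[of UNIV]]) (auto simp: less_imp_neq[symmetric])
  from integral_continuous_on_param[OF this] show ?thesis
    by (simp add: passage_shift_def[abs_def])
qed

lemma passage_shift_less_iff:
  assumes "\<mu> < m" "\<mu> < n" shows "passage_shift m < passage_shift n \<longleftrightarrow> n < m"
  using passage_shift_strict_antimono[of m n] passage_shift_strict_antimono[of n m] assms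
  by (cases m n rule: linorder_cases) auto

lemma critical_rate:
  assumes "\<beta> - a < c"
  shows "\<mu> < critical_rate c" "passage_shift (critical_rate c) = c"
proof -
  obtain m1 where m1: "\<mu> < m1" "c < passage_shift m1" using passage_shift_unbounded by blast
  \<comment> \<open>Solving the upper estimate of the passage shift for the speed gives this value.\<close>
  define m2 where "m2 = max m1 (\<mu> * c / (c - (\<beta> - a)))"
  have m2: "\<mu> < m2" "m1 \<le> m2" using m1 by (auto simp: m2_def)
  have "\<mu> * c / (c - (\<beta> - a)) \<le> m2" by (simp add: m2_def)
  then have "(\<beta> - a) * m2 \<le> c * (m2 - \<mu>)"
    using assms by (simp add: divide_le_eq algebra_simps)
  then have "(\<beta> - a) * (m2 / (m2 - \<mu>)) \<le> c" using m2 by (simp add: divide_le_eq)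
  with passage_shift_le[OF m2(1)] have "passage_shift m2 \<le> c" by simp
  then obtain m where m: "m1 \<le> m" "m \<le> m2" "passage_shift m = c"
    using IVT2'[of passage_shift m2 c m1] m1 m2 continuous_on_subset[OF passage_shift_cont, of "{m1..m2}"]
    by fastforce
  have "\<exists>!m. \<mu> < m \<and> passage_shift m = c"
  proof (rule ex1I[of _ m])
    show "\<mu> < m \<and> passage_shift m = c" using m m1 by auto
    then show "n = m" if "\<mu> < n \<and> passage_shift n = c" for n
      using that passage_shift_less_iff[of m n] passage_shift_less_iff[of n m] by auto
  qed
  from theI'[OF this] show "\<mu> < critical_rate c" "passage_shift (critical_rate c) = c"
    by (simp_all add: critical_rate_def)
qed

text \<open>
  The next two equivalences translate every order-topological statement about the critical rate into one
  about the passage shift at a fixed speed.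
\<close>

lemma less_critical_rate_iff:
  assumes "\<beta> - a < c" "\<mu> < m" shows "m < critical_rate c \<longleftrightarrow> c < passage_shift m"
  using passage_shift_less_iff[OF critical_rate(1)[OF assms(1)] assms(2)] critical_rate(2)[OF assms(1)] by simp

lemma critical_rate_less_iff:
  assumes "\<beta> - a < c" "\<mu> < m" shows "critical_rate c < m \<longleftrightarrow> passage_shift m < c"
  using passage_shift_less_iff[OF assms(2) critical_rate(1)[OF assms(1)]] critical_rate(2)[OF assms(1)] by simp

lemma critical_rate_strict_antimono: "strict_antimono_on {\<beta> - a<..} critical_rate"
proof (rule monotone_onI)
  fix c d assume "c \<in> {\<beta> - a<..}" "d \<in> {\<beta> - a<..}" "c < d"
  then show "critical_rate d < critical_rate c"
    using less_critical_rate_iff[of c "critical_rate d"] critical_rate[of d] by simp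
qed

lemma critical_rate_cont: "continuous_on {\<beta> - a<..} critical_rate"
  unfolding continuous_on_def
proof (intro ballI)
  fix c assume "c \<in> {\<beta> - a<..}"
  then have c: "\<beta> - a < c" by simp
  have inside: "eventually (\<lambda>x. \<beta> - a < x) (at c within {\<beta> - a<..})"
    by (auto simp: eventually_at_filter)
  show "(critical_rate \<longlongrightarrow> critical_rate c) (at c within {\<beta> - a<..})"
  proof (rule order_tendstoI)
    fix l assume l: "l < critical_rate c"
    show "\<forall>\<^sub>F x in at c within {\<beta> - a<..}. l < critical_rate x"
    proof (cases "l \<le> \<mu>")
      case True
      show ?thesis using inside by eventually_elim (use critical_rate(1) True in force)
    next
      case False
      then have "c < passage_shift l" using less_critical_rate_iff[OF c] l by simp
      then have "\<forall>\<^sub>F x in at c within {\<beta> - a<..}. x < passage_shift l"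
        by (rule order_tendstoD(2)[OF tendsto_ident_at])
      with inside show ?thesis by eventually_elim (use less_critical_rate_iff False in force)
    qed
  next
    fix u assume u: "critical_rate c < u"
    then have "\<mu> < u" using critical_rate(1)[OF c] by simp
    then have "passage_shift u < c" using critical_rate_less_iff[OF c] u by simp
    then have "\<forall>\<^sub>F x in at c within {\<beta> - a<..}. passage_shift u < x"
      by (rule order_tendstoD(1)[OF tendsto_ident_at])
    with inside show "\<forall>\<^sub>F x in at c within {\<beta> - a<..}. critical_rate x < u"
      by eventually_elim (use critical_rate_less_iff \<open>\<mu> < u\<close> in force)
  qed
qed

lemma critical_rate_at_small_shift: "filterlim critical_rate at_top (at_right (\<beta> - a))"
proof (subst filterlim_at_top_gt[of _ _ \<mu>], intro allI impI)
  fix Z assume Z: "\<mu> < Z"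
  have "\<forall>\<^sub>F x in at_right (\<beta> - a). x < passage_shift Z"
    by (rule order_tendstoD(2)[OF tendsto_ident_at passage_shift_gt[OF Z]])
  moreover have "\<forall>\<^sub>F x in at_right (\<beta> - a). \<beta> - a < x"
    by (auto simp: eventually_at_filter)
  ultimately show "\<forall>\<^sub>F x in at_right (\<beta> - a). Z \<le> critical_rate x"
    by eventually_elim (use less_critical_rate_iff Z in force)
qed

lemma critical_rate_at_large_shift: "(critical_rate \<longlongrightarrow> \<mu>) at_top"
proof (rule order_tendstoI)
  show "\<forall>\<^sub>F x in at_top. l < critical_rate x" if "l < \<mu>" for l
    using eventually_gt_at_top[of "\<beta> - a"] by eventually_elim (use critical_rate(1) that in force)
  show "\<forall>\<^sub>F x in at_top. critical_rate x < u" if "\<mu> < u" for u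
    using eventually_gt_at_top[of "\<beta> - a"] eventually_gt_at_top[of "passage_shift u"]
    by eventually_elim (use critical_rate_less_iff that in force)
qed

end

section \<open>Solutions driven by a Lipschitz shift\<close>

lemma Lipschitz_deriv_absolutely_integrable:
  fixes F :: "real \<Rightarrow> real"
  assumes F: "K-lipschitz_on UNIV F"
  shows "deriv F absolutely_integrable_on {c..d}"
proof (cases "c \<le> d")
  case True
  define N where "N = {x. \<not> F differentiable (at x)}"
  have N: "negligible N" using Lipschitz_differentiable_ae[OF F] by (simp add: N_def)
  have "(\<lambda>x. if x \<in> N then 0 else deriv F x) absolutely_integrable_on {c..d}"
  proof (rule absolutely_integrable_integrable_bound)
    show "norm (if x \<in> N then 0 else deriv F x) \<le> K" for x
      using Lipschitz_abs_deriv_le[OF F, of x] lipschitz_on_nonneg[OF F] by (simp add: N_def)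
    show "(\<lambda>x. if x \<in> N then 0 else deriv F x) integrable_on {c..d}"
      using Lipschitz_has_integral_deriv[OF F True]
      by (intro integrable_spike[OF has_integral_integrable N]) auto
  qed (rule integrable_const_ivl)
  then show ?thesis by (rule absolutely_integrable_spike[OF _ N]) auto
qed simp

text \<open>
  The sign of the derivative off a null set decides, because a Lipschitz function is the integral of
  its derivative. Freezing \<open>V\<close> outside \<open>[c, d]\<close> makes it Lipschitz on the whole line.
\<close>

lemma Lipschitz_nonincreasing_if_deriv_nonpos_ae:
  fixes V :: "real \<Rightarrow> real"
  assumes V: "K-lipschitz_on {c..d} V" and "c \<le> d" and N: "negligible N"
    and nonpos: "\<And>t D. t \<in> {c<..<d} - N \<Longrightarrow> (V has_real_derivative D) (at t) \<Longrightarrow> D \<le> 0"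
  shows "V d \<le> V c"
proof -
  define W where "W t = V (max c (min d t))" for t
  have W: "K-lipschitz_on UNIV W"
  proof (rule lipschitz_onI)
    fix s t :: real
    have "dist (W s) (W t) \<le> K * dist (max c (min d s)) (max c (min d t))"
      unfolding W_def using \<open>c \<le> d\<close> by (intro lipschitz_onD[OF V]) auto
    also have "\<dots> \<le> K * dist s t"
      using lipschitz_on_nonneg[OF V] by (intro mult_left_mono) (auto simp: dist_real_def)
    finally show "dist (W s) (W t) \<le> K * dist s t" .
  qed (rule lipschitz_on_nonneg[OF V])
  define M where "M = N \<union> {x. \<not> W differentiable (at x)} \<union> {c, d}"
  have M: "negligible M"
    unfolding M_def using N Lipschitz_differentiable_ae[OF W] by (intro negligible_Un) auto
  have sign: "deriv W t \<le> 0" if "t \<in> {c..d}" "t \<notin> M" for t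
  proof -
    have t: "t \<in> {c<..<d} - N" and diff: "W differentiable (at t)"
      using that by (auto simp: M_def)
    then have "(W has_real_derivative deriv W t) (at t)"
      by (simp add: DERIV_deriv_iff_real_differentiable)
    then have "(V has_real_derivative deriv W t) (at t)"
      by (rule has_field_derivative_transform_within_open[where S = "{c<..<d}"]) (use t in \<open>auto simp: W_def\<close>)
    then show ?thesis by (rule nonpos[OF t])
  qed
  have int: "((\<lambda>t. if t \<in> M then 0 else deriv W t) has_integral W d - W c) {c..d}"
    by (rule has_integral_spike[OF M _ Lipschitz_has_integral_deriv[OF W \<open>c \<le> d\<close>]]) auto
  have "W d - W c \<le> 0"
    by (rule has_integral_le[OF int has_integral_0]) (use sign in auto)
  then show ?thesis using \<open>c \<le> d\<close> by (simp add: W_def)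
qed

text \<open>
  The integrated form of \<open>(y - lam)' = f y\<close>. Unlike the Caratheodory form it does not mention the
  derivative of \<open>lam\<close>, and unlike the differential form it passes to closed ends of \<open>J\<close> and can be pasted at
  a common endpoint without a matching condition on derivatives.
\<close>

definition solves_shifted :: "(real \<Rightarrow> real) \<Rightarrow> (real \<Rightarrow> real) \<Rightarrow> real set \<Rightarrow> (real \<Rightarrow> real) \<Rightarrow> bool"
  where "solves_shifted f lam J y \<longleftrightarrow> (\<forall>s\<in>J. \<forall>t\<in>J. s \<le> t \<longrightarrow> continuous_on {s..t} y \<and>
    ((\<lambda>r. f (y r)) has_integral (y t - lam t) - (y s - lam s)) {s..t})"

lemma solves_shiftedD:
  assumes "solves_shifted f lam J y" "s \<in> J" "t \<in> J" "s \<le> t"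
  shows "continuous_on {s..t} y" "((\<lambda>r. f (y r)) has_integral (y t - lam t) - (y s - lam s)) {s..t}"
  using assms by (auto simp: solves_shifted_def)

text \<open>
  The two forms differ by the integral of the derivative of \<open>lam\<close>, which is the increment of \<open>lam\<close>.
\<close>

lemma caratheodory_iff_solves_shifted:
  fixes f lam :: "real \<Rightarrow> real"
  assumes f: "continuous_on UNIV f" and lam: "K-lipschitz_on UNIV lam"
  shows "caratheodory_solution f (deriv lam) J y \<longleftrightarrow> is_interval J \<and> solves_shifted f lam J y"
proof
  assume sol: "caratheodory_solution f (deriv lam) J y"
  then have int: "is_interval J" by (simp add: caratheodory_solution_def)
  have sub: "r \<in> J" if "s \<in> J" "t \<in> J" "s \<le> r" "r \<le> t" for r s t
    by (rule mem_is_interval_1_I[OF int that])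
  have eq: "(\<lambda>s. f (y s) + deriv lam s) absolutely_integrable_on {s..t}"
      "y t = y s + integral {s..t} (\<lambda>s. f (y s) + deriv lam s)" if "s \<in> J" "t \<in> J" "s \<le> t" for s t
    using sol that unfolding caratheodory_solution_def by blast+
  have "continuous_on {s..t} y \<and> ((\<lambda>r. f (y r)) has_integral (y t - lam t) - (y s - lam s)) {s..t}"
    if "s \<in> J" "t \<in> J" "s \<le> t" for s t
  proof
    have I: "(\<lambda>s. f (y s) + deriv lam s) integrable_on {s..t}"
      using eq(1)[OF that] by (rule set_lebesgue_integral_eq_integral(1))
    have "continuous_on {s..t} (\<lambda>r. y s + integral {s..r} (\<lambda>s. f (y s) + deriv lam s))"
      by (rule continuous_on_add[OF continuous_on_const indefinite_integral_continuous_1[OF I]])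
    then show "continuous_on {s..t} y"
    proof (rule continuous_on_eq)
      show "y s + integral {s..r} (\<lambda>s. f (y s) + deriv lam s) = y r" if "r \<in> {s..t}" for r
        using that \<open>s \<in> J\<close> \<open>t \<in> J\<close> by (intro eq(2)[symmetric] sub[of s t r]) auto
    qed
    have "((\<lambda>s. f (y s) + deriv lam s) has_integral y t - y s) {s..t}"
      using integrable_integral[OF I] unfolding eq(2)[OF that] by simp
    from has_integral_diff[OF this Lipschitz_has_integral_deriv[OF lam that(3)]]
    show "((\<lambda>r. f (y r)) has_integral (y t - lam t) - (y s - lam s)) {s..t}"
      by (simp add: algebra_simps)
  qed
  with int show "is_interval J \<and> solves_shifted f lam J y" by (simp add: solves_shifted_def)
next
  assume "is_interval J \<and> solves_shifted f lam J y"
  then have int: "is_interval J" and sol: "solves_shifted f lam J y" by auto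
  have "(\<lambda>r. f (y r) + deriv lam r) absolutely_integrable_on {s..t} \<and>
      y t = y s + integral {s..t} (\<lambda>r. f (y r) + deriv lam r)" if "s \<in> J" "t \<in> J" "s \<le> t" for s t
  proof
    have "continuous_on {s..t} (\<lambda>r. f (y r))"
      by (rule continuous_on_compose2[OF f solves_shiftedD(1)[OF sol that]]) auto
    then show "(\<lambda>r. f (y r) + deriv lam r) absolutely_integrable_on {s..t}"
      by (rule set_integral_add(1)[OF absolutely_integrable_continuous_real
            Lipschitz_deriv_absolutely_integrable[OF lam]])
    have sum: "((\<lambda>r. f (y r) + deriv lam r) has_integral y t - y s) {s..t}"
      using has_integral_add[OF solves_shiftedD(2)[OF sol that] Lipschitz_has_integral_deriv[OF lam that(3)]]
      by (simp add: algebra_simps)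
    show "y t = y s + integral {s..t} (\<lambda>r. f (y r) + deriv lam r)"
      unfolding integral_unique[OF sum] by simp
  qed
  with int show "caratheodory_solution f (deriv lam) J y"
    unfolding caratheodory_solution_def by blast
qed

lemma solves_shifted_deriv:
  fixes f lam :: "real \<Rightarrow> real"
  assumes f: "continuous_on UNIV f" and sol: "solves_shifted f lam J y"
    and st: "s \<in> J" "t \<in> J" "is_interval J" and r: "r \<in> {s..t}"
  shows "((\<lambda>r. y r - lam r) has_real_derivative f (y r)) (at r within {s..t})"
proof -
  have sub: "r \<in> J" if "s \<le> r" "r \<le> t" for r
    by (rule mem_is_interval_1_I[OF st(3,1,2) that])
  have "continuous_on {s..t} (\<lambda>r. f (y r))"
    by (rule continuous_on_compose2[OF f solves_shiftedD(1)[OF sol st(1,2)]]) (use r in auto)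
  then have "((\<lambda>u. integral {s..u} (\<lambda>r. f (y r))) has_real_derivative f (y r)) (at r within {s..t})"
    unfolding has_real_derivative_iff_has_vector_derivative
    by (rule integral_has_vector_derivative[OF _ r])
  then have "((\<lambda>u. (y s - lam s) + integral {s..u} (\<lambda>r. f (y r))) has_real_derivative f (y r)) (at r within {s..t})"
    using DERIV_add[OF DERIV_const, of _ _ _ _ "y s - lam s"] by simp
  then show ?thesis
  proof (rule has_field_derivative_transform_within[OF _ zero_less_one r])
    show "(y s - lam s) + integral {s..u} (\<lambda>r. f (y r)) = y u - lam u" if "u \<in> {s..t}" for u
      using solves_shiftedD(2)[OF sol st(1) sub[of u]] that by (simp add: integral_unique)
  qed
qed

lemma solves_shifted_cong:
  assumes "solves_shifted f lam J y" "is_interval J" and eq: "\<And>r. r \<in> J \<Longrightarrow> w r = y r"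
  shows "solves_shifted f lam J w"
  unfolding solves_shifted_def
proof (intro ballI impI conjI)
  fix s t assume st: "s \<in> J" "t \<in> J" "s \<le> t"
  have r: "w r = y r" if "r \<in> {s..t}" for r
    by (rule eq, rule mem_is_interval_1_I[OF assms(2) st(1,2)]) (use that in auto)
  show "continuous_on {s..t} w"
    by (rule continuous_on_eq[OF solves_shiftedD(1)[OF assms(1) st]]) (simp add: r)
  show "((\<lambda>r. f (w r)) has_integral (w t - lam t) - (w s - lam s)) {s..t}"
    unfolding eq[OF st(1)] eq[OF st(2)]
    by (rule has_integral_eq[OF _ solves_shiftedD(2)[OF assms(1) st]]) (simp add: r)
qed

lemma solves_shifted_combine:
  assumes y: "solves_shifted f lam {..b} y" and z: "solves_shifted f lam {b..c} z" and "y b = z b"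
  shows "solves_shifted f lam {..c} (\<lambda>t. if t \<le> b then y t else z t)"
proof -
  define w where "w t = (if t \<le> b then y t else z t)" for t
  have wy: "solves_shifted f lam {..b} w"
    by (rule solves_shifted_cong[OF y is_interval_ic]) (simp add: w_def)
  have wz: "solves_shifted f lam {b..c} w"
  proof (rule solves_shifted_cong[OF z is_interval_cc])
    show "w r = z r" if "r \<in> {b..c}" for r
      using that assms(3) by (cases "r = b") (auto simp: w_def)
  qed
  have "solves_shifted f lam {..c} w"
    unfolding solves_shifted_def
  proof (intro ballI impI)
    fix s t assume st: "s \<in> {..c}" "t \<in> {..c}" "s \<le> t"
    consider "t \<le> b" | "b \<le> s" | "s \<le> b" "b \<le> t" using st by linarith
    then show "continuous_on {s..t} w \<and> ((\<lambda>r. f (w r)) has_integral (w t - lam t) - (w s - lam s)) {s..t}"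
    proof cases
      case 1
      then show ?thesis using st by (intro conjI solves_shiftedD[OF wy]) simp_all
    next
      case 2
      then show ?thesis using st by (intro conjI solves_shiftedD[OF wz]) simp_all
    next
      case 3
      have mem: "s \<in> {..b}" "b \<in> {..b}" "b \<in> {b..c}" "t \<in> {b..c}" using st 3 by auto
      note l = solves_shiftedD[OF wy mem(1,2) 3(1)] and r = solves_shiftedD[OF wz mem(3,4) 3(2)]
      have "continuous_on ({s..b} \<union> {b..t}) w"
        by (rule continuous_on_closed_Un[OF closed_atLeastAtMost closed_atLeastAtMost l(1) r(1)])
      then have "continuous_on {s..t} w" using 3 by (simp add: ivl_disj_un_two_touch(4))
      moreover have "((\<lambda>r. f (w r)) has_integral (w t - lam t) - (w s - lam s)) {s..t}"
        by (rule has_integral_eq_rhs[OF has_integral_combine[OF 3 l(2) r(2)]]) simp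
      ultimately show ?thesis by blast
    qed
  qed
  then show ?thesis by (simp add: w_def[abs_def])
qed

text \<open>
  Picard's theorem for \<open>x = y - lam\<close>. Freezing \<open>f\<close> outside \<open>[y0 - 1, y0 + 1]\<close> makes it globally Lipschitz, with
  constant \<open>K\<close>, so the integral operator contracts by \<open>1/2\<close> on an interval of length \<open>\<delta>\<close> with
  \<open>\<delta> K \<le> 1/2\<close>. By continuity the fixed point does not leave \<open>[y0 - 1, y0 + 1]\<close> for a short time, and there
  it solves the original equation. Since functions on the whole line form the complete space at hand, time is
  clipped to that interval as well.
\<close>

lemma local_existence:
  fixes f lam :: "real \<Rightarrow> real"
  assumes lip: "\<And>c d. \<exists>K. K-lipschitz_on {c..d} f" and lam: "continuous_on UNIV lam"
  shows "\<exists>\<delta>>0. \<exists>z. z t0 = y0 \<and> solves_shifted f lam {t0..t0+\<delta>} z"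
proof -
  obtain K where K: "K-lipschitz_on {y0-1..y0+1} f" using lip by blast
  have K0: "K \<ge> 0" using lipschitz_on_nonneg[OF K] .
  have lam_cont: "continuous_on S lam" for S using lam continuous_on_subset by blast
  define cut where "cut u = max (y0-1) (min (y0+1) u)" for u
  define g where "g u = f (cut u)" for u
  have g_lip: "\<bar>g u - g v\<bar> \<le> K * \<bar>u - v\<bar>" for u v
  proof -
    have "\<bar>g u - g v\<bar> \<le> K * \<bar>cut u - cut v\<bar>"
      using lipschitz_onD[OF K, of "cut u" "cut v"] by (simp add: g_def cut_def dist_real_def)
    also have "\<dots> \<le> K * \<bar>u - v\<bar>"
      by (intro mult_left_mono K0) (auto simp: cut_def)
    finally show ?thesis .
  qed
  have "K-lipschitz_on UNIV g"
    by (rule lipschitz_onI) (use g_lip K0 in \<open>auto simp: dist_real_def\<close>)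
  then have g_cont: "continuous_on UNIV g" by (rule lipschitz_on_continuous_on)
  define \<delta> where "\<delta> = 1 / (2 * (K + 1))"
  have \<delta>: "\<delta> > 0" "\<delta> * K \<le> 1/2" using K0 by (auto simp: \<delta>_def field_simps)
  define clip where "clip t = max t0 (min (t0 + \<delta>) t)" for t
  have clip: "clip t \<in> {t0..t0+\<delta>}" for t using \<delta> by (auto simp: clip_def)
  have clip_cont: "continuous_on UNIV clip"
    unfolding clip_def[abs_def]
    by (intro continuous_on_max continuous_on_min continuous_on_const continuous_on_id)
  have clip_id: "t \<in> {t0..t0+\<delta>} \<Longrightarrow> clip t = t" for t by (auto simp: clip_def)
  define G where "G h t = (y0 - lam t0) + integral {t0..clip t} (\<lambda>s. g (h s + lam s))" for h t
  have integrand: "continuous_on S (\<lambda>s. g (apply_bcontfun h s + lam s))" for h S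
    by (rule continuous_on_compose2[OF g_cont])
       (auto intro!: continuous_intros continuous_on_apply_bcontfun lam_cont)
  have G_bcont: "G (apply_bcontfun h) \<in> bcontfun" for h
  proof -
    have *: "continuous_on {t0..t0+\<delta>} (\<lambda>u. (y0 - lam t0) + integral {t0..u} (\<lambda>s. g (apply_bcontfun h s + lam s)))"
      by (rule continuous_on_add[OF continuous_on_const indefinite_integral_continuous_1])
         (rule integrable_continuous_real[OF integrand])
    have "continuous_on UNIV (G (apply_bcontfun h))"
      unfolding G_def
      by (rule continuous_on_compose2[OF *, where f = clip])
         (use clip clip_cont in auto)
    moreover have "bounded (range (G (apply_bcontfun h)))"
    proof (rule bounded_subset)
      show "bounded ((\<lambda>u. (y0 - lam t0) + integral {t0..u} (\<lambda>s. g (apply_bcontfun h s + lam s))) ` {t0..t0+\<delta>})"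
        by (intro compact_imp_bounded compact_continuous_image *) auto
      show "range (G (apply_bcontfun h)) \<subseteq>
          (\<lambda>u. (y0 - lam t0) + integral {t0..u} (\<lambda>s. g (apply_bcontfun h s + lam s))) ` {t0..t0+\<delta>}"
        using clip by (auto simp: G_def)
    qed
    ultimately show ?thesis by (simp add: bcontfun_def)
  qed
  define T where "T h = Bcontfun (G (apply_bcontfun h))" for h
  have T: "apply_bcontfun (T h) = G (apply_bcontfun h)" for h
    unfolding T_def using G_bcont by (rule Bcontfun_inverse)
  have "dist (T h) (T k) \<le> 1/2 * dist h k" for h k
  proof (rule dist_bound)
    fix t
    let ?h = "\<lambda>s. g (apply_bcontfun h s + lam s)" and ?k = "\<lambda>s. g (apply_bcontfun k s + lam s)"
    have "dist (T h t) (T k t) = \<bar>integral {t0..clip t} ?h - integral {t0..clip t} ?k\<bar>"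
      by (simp add: T G_def dist_real_def)
    also have "\<dots> = \<bar>integral {t0..clip t} (\<lambda>s. ?h s - ?k s)\<bar>"
      by (simp add: integral_diff integrable_continuous_real[OF integrand])
    also have "\<dots> \<le> (K * dist h k) * (clip t - t0)"
    proof -
      have "norm (integral {t0..clip t} (\<lambda>s. ?h s - ?k s)) \<le> (K * dist h k) * (clip t - t0)"
      proof (rule integral_bound)
        show "t0 \<le> clip t" using clip[of t] by simp
        show "continuous_on {t0..clip t} (\<lambda>s. ?h s - ?k s)" by (rule continuous_on_diff[OF integrand integrand])
        fix s
        have "\<bar>?h s - ?k s\<bar> \<le> K * \<bar>apply_bcontfun h s - apply_bcontfun k s\<bar>"
          using g_lip[of "apply_bcontfun h s + lam s" "apply_bcontfun k s + lam s"] by simp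
        also have "\<dots> \<le> K * dist h k"
          using dist_bounded[of h s k] by (intro mult_left_mono K0) (simp add: dist_real_def)
        finally show "norm (?h s - ?k s) \<le> K * dist h k" by simp
      qed
      then show ?thesis by simp
    qed
    also have "\<dots> \<le> (K * dist h k) * \<delta>"
      using clip[of t] K0 by (intro mult_left_mono mult_nonneg_nonneg) auto
    also have "\<dots> = (\<delta> * K) * dist h k" by simp
    also have "\<dots> \<le> 1/2 * dist h k" by (intro mult_right_mono \<delta>) auto
    finally show "dist (T h t) (T k t) \<le> 1/2 * dist h k" .
  qed
  then have "\<exists>!h. T h = h"
    by (intro banach_fix_type[where c = "1/2"]) auto
  then obtain h where h: "T h = h" by blast
  define z where "z t = apply_bcontfun h t + lam t" for t
  have z_cont: "continuous_on S z" for S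
    unfolding z_def by (intro continuous_intros continuous_on_apply_bcontfun lam_cont)
  have h_eq: "apply_bcontfun h t = (y0 - lam t0) + integral {t0..t} (\<lambda>s. g (z s))"
    if "t \<in> {t0..t0+\<delta>}" for t
  proof -
    have "apply_bcontfun h t = G (apply_bcontfun h) t" using T[of h] h by simp
    then show ?thesis using clip_id[OF that] by (simp add: G_def z_def)
  qed
  have z0: "z t0 = y0" using h_eq[of t0] \<delta> by (simp add: z_def)
  have "continuous (at t0) z" using z_cont[of UNIV] by (simp add: continuous_on_eq_continuous_at)
  then obtain e where e: "e > 0" "\<And>t. \<bar>t - t0\<bar> < e \<Longrightarrow> \<bar>z t - y0\<bar> < 1"
    using z0 continuous_at_eps_delta[THEN iffD1, rule_format, OF _ zero_less_one, of t0 z]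
    unfolding dist_real_def by auto
  define \<eta> where "\<eta> = min \<delta> (e / 2)"
  have \<eta>: "\<eta> > 0" "\<eta> \<le> \<delta>" "\<eta> < e" using \<delta> e by (auto simp: \<eta>_def)
  have g_f: "g (z t) = f (z t)" if "t \<in> {t0..t0+\<eta>}" for t
  proof -
    have "\<bar>z t - y0\<bar> < 1" using that \<eta> by (intro e(2)) auto
    then have "cut (z t) = z t" by (auto simp: cut_def)
    then show ?thesis by (simp add: g_def)
  qed
  have "solves_shifted f lam {t0..t0+\<eta>} z"
    unfolding solves_shifted_def
  proof (intro ballI impI conjI z_cont)
    fix s t assume st: "s \<in> {t0..t0+\<eta>}" "t \<in> {t0..t0+\<eta>}" "s \<le> t"
    have gi: "(\<lambda>r. g (z r)) integrable_on {u..v}" for u v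
      by (rule integrable_continuous_real, rule continuous_on_compose2[OF g_cont z_cont]) auto
    have "integral {t0..s} (\<lambda>r. g (z r)) + integral {s..t} (\<lambda>r. g (z r)) = integral {t0..t} (\<lambda>r. g (z r))"
      using st by (intro Henstock_Kurzweil_Integration.integral_combine gi) auto
    then have "integral {s..t} (\<lambda>r. g (z r)) = (z t - lam t) - (z s - lam s)"
      using st \<eta> h_eq[of s] h_eq[of t] by (simp add: z_def)
    then have "((\<lambda>r. g (z r)) has_integral (z t - lam t) - (z s - lam s)) {s..t}"
      using integrable_integral[OF gi, of s t] by simp
    then show "((\<lambda>r. f (z r)) has_integral (z t - lam t) - (z s - lam s)) {s..t}"
      by (rule has_integral_eq[rotated]) (use st in \<open>auto intro!: g_f\<close>)
  qed
  with \<eta> z0 show ?thesis by blast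
qed

section \<open>Shifts below the critical rate do not tip\<close>

lemma interval_unbounded_below:
  fixes I :: "real set"
  assumes "is_interval I" "{..t0} \<subseteq> I" "t \<in> I" "s \<le> t"
  shows "s \<in> I"
proof -
  have "min s t0 \<in> I" using assms(2) by auto
  from mem_is_interval_1_I[OF assms(1) this assms(3)] show ?thesis using assms(4) by auto
qed

context potential_well
begin

text \<open>
  An antiderivative of \<open>m / (f x + m)\<close>. Freezing \<open>f\<close> outside \<open>[a, \<beta>]\<close> keeps the denominator positive, and starting
  the integral at \<open>a - 1\<close> makes the function differentiable at \<open>a\<close> from both sides.
\<close>

definition travel :: "real \<Rightarrow> real \<Rightarrow> real"
  where "travel m x = integral {a - 1..x} (\<lambda>u. m / (f (max a (min \<beta> u)) + m))"

lemma travel_integrand_cont: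
  assumes "\<mu> < m" shows "continuous_on S (\<lambda>u. m / (f (max a (min \<beta> u)) + m))"
proof -
  have "f (max a (min \<beta> u)) + m \<noteq> 0" for u
    using denom_pos[OF assms, of "max a (min \<beta> u)"] a_less by auto
  then show ?thesis
    by (intro continuous_on_divide continuous_on_add continuous_on_const continuous_on_compose2[OF f_cont[of UNIV]]
        continuous_on_max continuous_on_min continuous_on_id) auto
qed

lemma travel_deriv:
  assumes "\<mu> < m" "x \<in> {a..\<beta>}"
  shows "(travel m has_real_derivative m / (f x + m)) (at x)"
proof -
  have "(travel m has_vector_derivative m / (f (max a (min \<beta> x)) + m)) (at x within {a-1..\<beta>+1})"
    unfolding travel_def[abs_def]
    by (rule integral_has_vector_derivative[OF travel_integrand_cont[OF assms(1)]]) (use assms in auto)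
  moreover have "at x within {a-1..\<beta>+1} = at x"
    using assms by (intro at_within_interior) auto
  moreover have "max a (min \<beta> x) = x" using assms by auto
  ultimately show ?thesis by (simp add: has_real_derivative_iff_has_vector_derivative)
qed

lemma travel_diff:
  assumes "\<mu> < m" shows "travel m \<beta> - travel m a = passage_shift m"
proof -
  have "((\<lambda>x. m / (f x + m)) has_integral travel m \<beta> - travel m a) {a..\<beta>}"
  proof (rule fundamental_theorem_of_calculus)
    show "(travel m has_vector_derivative m / (f x + m)) (at x within {a..\<beta>})" if "x \<in> {a..\<beta>}" for x
      using has_field_derivative_at_within[OF travel_deriv[OF assms that]]
      by (simp add: has_real_derivative_iff_has_vector_derivative)
  qed (use a_less in simp)
  then show ?thesis by (simp add: passage_shift_def integral_unique)
qed

end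

text \<open>
  A solution that starts at \<open>a\<close> and is driven by a shift of total height \<open>c\<close> that is slower than the critical
  rate wherever it has a speed.
\<close>

locale slow_shift = potential_well +
  fixes lam :: "real \<Rightarrow> real" and K c :: real and I :: "real set" and y :: "real \<Rightarrow> real" and t0 :: real
  assumes lam: "K-lipschitz_on UNIV lam" and lam_mono: "mono lam"
    and lam_start: "(lam \<longlongrightarrow> 0) at_bot" and lam_end: "(lam \<longlongrightarrow> c) at_top"
    and c: "\<beta> - a < c"
    and slow: "\<And>t. lam differentiable (at t) \<Longrightarrow> deriv lam t < critical_rate c"
    and sol: "solves_shifted f lam I y" and int: "is_interval I" and low: "{..t0} \<subseteq> I"
    and start: "(y \<longlongrightarrow> a) at_bot"
begin

abbreviation (input) "m \<equiv> critical_rate c"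

lemma m: "\<mu> < m" "passage_shift m = c" "0 < m"
  using critical_rate[OF c] \<mu>_pos by auto

lemma I_downward: "t \<in> I \<Longrightarrow> s \<le> t \<Longrightarrow> s \<in> I"
  by (rule interval_unbounded_below[OF int low])

lemma lam_le: "lam t \<le> c"
proof (rule tendsto_lowerbound[OF lam_end])
  show "eventually (\<lambda>s. lam t \<le> lam s) at_top"
    using eventually_ge_at_top[of t] by eventually_elim (rule monoD[OF lam_mono])
qed simp

lemma lam_cont: "continuous_on S lam"
  using lipschitz_on_continuous_on[OF lam] continuous_on_subset by blast

lemma y_cont: "t \<in> I \<Longrightarrow> continuous_on {s..t} y"
  using solves_shiftedD(1)[OF sol I_downward[of t s]] by (cases "s \<le> t") auto

lemma x_int: "t \<in> I \<Longrightarrow> s \<le> t \<Longrightarrow> ((\<lambda>r. f (y r)) has_integral (y t - lam t) - (y s - lam s)) {s..t}"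
  using solves_shiftedD(2)[OF sol I_downward[of t s]] by blast

lemma x_deriv:
  assumes "t \<in> I" "r \<in> {s..t}"
  shows "((\<lambda>r. y r - lam r) has_real_derivative f (y r)) (at r within {s..t})"
  using assms by (intro solves_shifted_deriv[OF f_cont sol _ _ int]) (auto intro: I_downward)

text \<open>
  Below \<open>a\<close> both contributions to the motion point upwards: \<open>f > 0\<close>, and the shift is nondecreasing. So a
  solution below \<open>a\<close> at time \<open>t\<close> was at or below its present value at all earlier times, and could not have
  started at \<open>a\<close>.
\<close>

lemma y_ge_a:
  assumes t: "t \<in> I" shows "a \<le> y t"
proof (rule ccontr)
  assume "\<not> a \<le> y t"
  then have yt: "y t < a" by simp
  have below: "y s < a" if "s \<le> t" for s
  proof (rule ccontr)
    assume "\<not> y s < a"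
    define A where "A = {s..t} \<inter> y -` {a..}"
    have "closed A"
      unfolding A_def by (rule continuous_closed_preimage[OF y_cont[OF t]]) auto
    moreover have "A \<noteq> {}" "bdd_above A"
      using \<open>\<not> y s < a\<close> that by (auto simp: A_def intro!: bdd_aboveI[of _ t])
    ultimately have "Sup A \<in> A" by (intro closed_contains_Sup)
    \<comment> \<open>The last time before time t at which the solution is not below a.\<close>
    define \<tau> where "\<tau> = Sup A"
    have \<tau>: "s \<le> \<tau>" "\<tau> < t" "a \<le> y \<tau>"
      using \<open>Sup A \<in> A\<close> yt by (auto simp: A_def \<tau>_def order.strict_iff_order)
    have after: "y r < a" if "\<tau> < r" "r \<le> t" for r
    proof (rule ccontr)
      assume "\<not> y r < a"
      then have "r \<in> A" using that \<tau> by (auto simp: A_def)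
      then show False using cSup_upper[OF _ \<open>bdd_above A\<close>] that by (fastforce simp: \<tau>_def)
    qed
    have "((\<lambda>r. if r = \<tau> then 0 else f (y r)) has_integral (y t - lam t) - (y \<tau> - lam \<tau>)) {\<tau>..t}"
      by (rule has_integral_spike_finite[OF _ _ x_int[OF t], of "{\<tau>}"]) (use \<tau> in auto)
    then have "0 \<le> (y t - lam t) - (y \<tau> - lam \<tau>)"
      by (rule has_integral_nonneg) (use after f_pos in \<open>auto intro!: less_imp_le\<close>)
    moreover have "lam \<tau> \<le> lam t" using \<tau> by (intro monoD[OF lam_mono]) auto
    ultimately show False using \<tau> yt by simp
  qed
  have "y s \<le> y t" if "s \<le> t" for s
  proof -
    have "0 \<le> (y t - lam t) - (y s - lam s)"
      by (rule has_integral_nonneg[OF x_int[OF t that]]) (use below f_pos in \<open>auto intro!: less_imp_le\<close>)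
    moreover have "lam s \<le> lam t" using that by (rule monoD[OF lam_mono])
    ultimately show ?thesis by simp
  qed
  then have "eventually (\<lambda>s. y s \<le> y t) at_bot"
    by (rule eventually_mono[OF eventually_le_at_bot])
  then have "a \<le> y t" by (rule tendsto_upperbound[OF start]) simp
  with yt show False by simp
qed

text \<open>
  Progress of the solution, measured by the shift that a ramp at the critical rate would spend on it,
  minus the shift actually spent.
\<close>

definition energy :: "real \<Rightarrow> real"
  where "energy t = travel m (y t) - lam t"

text \<open>
  The speed of \<open>y\<close> is \<open>f y + l\<close>, so the chain rule gives \<open>m (f y + l) / (f y + m) - l\<close>, which simplifies to the
  stated quotient. Its sign shows that slower than \<open>m\<close> is less efficient.
\<close>

lemma energy_deriv:
  assumes t: "t \<in> I" "r \<in> {s<..<t}" and yr: "y r \<in> {a..\<beta>}" and l: "(lam has_real_derivative l) (at r)"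
  shows "(energy has_real_derivative f (y r) * (m - l) / (f (y r) + m)) (at r)"
proof -
  have "((\<lambda>r. y r - lam r) has_real_derivative f (y r)) (at r within {s..t})"
    using t by (intro x_deriv) auto
  moreover have "at r within {s..t} = at r" using t by (intro at_within_interior) auto
  ultimately have "((\<lambda>r. y r - lam r) has_real_derivative f (y r)) (at r)" by simp
  from DERIV_add[OF this l] have "(y has_real_derivative f (y r) + l) (at r)" by simp
  from DERIV_chain2[OF travel_deriv[OF m(1) yr] this]
  have "(energy has_real_derivative m / (f (y r) + m) * (f (y r) + l) - l) (at r)"
    unfolding energy_def[abs_def] by (rule DERIV_diff[OF _ l])
  moreover have "m / (f (y r) + m) * (f (y r) + l) - l = f (y r) * (m - l) / (f (y r) + m)"
    using denom_pos[OF m(1) yr] by (simp add: field_simps)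
  ultimately show ?thesis by simp
qed

lemma energy_Lipschitz:
  assumes t: "t \<in> I" and y: "\<And>r. r \<in> {s..t} \<Longrightarrow> y r \<in> {a..\<beta>}"
  shows "\<exists>M. M-lipschitz_on {s..t} energy"
proof -
  define B where "B = m / (m - \<mu>)"
  have B: "0 \<le> B" using m by (simp add: B_def)
  have K: "0 \<le> K" using lipschitz_on_nonneg[OF lam] .
  have travel: "norm (travel m u - travel m v) \<le> B * norm (u - v)" if "u \<in> {a..\<beta>}" "v \<in> {a..\<beta>}" for u v
  proof (rule field_differentiable_bound[of "{a..\<beta>}"])
    fix z assume z: "z \<in> {a..\<beta>}"
    show "(travel m has_field_derivative m / (f z + m)) (at z within {a..\<beta>})"
      by (rule has_field_derivative_at_within[OF travel_deriv[OF m(1) z]])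
    have "m / (f z + m) \<le> B" unfolding B_def
      using m f_ge[OF z] by (intro divide_left_mono mult_pos_pos) auto
    moreover have "0 \<le> m / (f z + m)" using m denom_pos[OF m(1) z] by simp
    ultimately show "norm (m / (f z + m)) \<le> B" by (simp only: real_norm_def abs_of_nonneg)
  qed (use that in auto)
  have x: "norm ((y u - lam u) - (y v - lam v)) \<le> \<mu> * norm (u - v)" if "u \<in> {s..t}" "v \<in> {s..t}" for u v
  proof (rule field_differentiable_bound[of "{s..t}"])
    fix z assume z: "z \<in> {s..t}"
    show "((\<lambda>r. y r - lam r) has_field_derivative f (y z)) (at z within {s..t})"
      by (rule x_deriv[OF t z])
    show "norm (f (y z)) \<le> \<mu>" using f_ge[OF y[OF z]] f_nonpos[OF y[OF z]] by simp
  qed (use that in auto)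
  have "\<bar>energy u - energy v\<bar> \<le> (B * (\<mu> + K) + K) * \<bar>u - v\<bar>" if "u \<in> {s..t}" "v \<in> {s..t}" for u v
  proof -
    have l: "\<bar>lam u - lam v\<bar> \<le> K * \<bar>u - v\<bar>"
      using lipschitz_onD[OF lam, of u v] by (simp add: dist_real_def)
    have "\<bar>y u - y v\<bar> \<le> (\<mu> + K) * \<bar>u - v\<bar>"
      using x[OF that] l unfolding real_norm_def distrib_right by linarith
    then have "B * \<bar>y u - y v\<bar> \<le> B * ((\<mu> + K) * \<bar>u - v\<bar>)" using B by (rule mult_left_mono)
    moreover have "\<bar>travel m (y u) - travel m (y v)\<bar> \<le> B * \<bar>y u - y v\<bar>"
      using travel[OF y[OF that(1)] y[OF that(2)]] by simp
    moreover have "(B * (\<mu> + K) + K) * \<bar>u - v\<bar> = B * ((\<mu> + K) * \<bar>u - v\<bar>) + K * \<bar>u - v\<bar>"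
      by (simp add: algebra_simps)
    ultimately show ?thesis
      using l unfolding energy_def by linarith
  qed
  then have "(B * (\<mu> + K) + K)-lipschitz_on {s..t} energy"
    using B K \<mu>_pos by (intro lipschitz_onI) (auto simp: dist_real_def)
  then show ?thesis by blast
qed

lemma energy_antimono:
  assumes t: "t \<in> I" "s \<le> t" and y: "\<And>r. r \<in> {s..t} \<Longrightarrow> y r \<in> {a..\<beta>}"
  shows "energy t \<le> energy s"
proof -
  obtain M where M: "M-lipschitz_on {s..t} energy" using energy_Lipschitz[OF t(1) y] by blast
  show ?thesis
  proof (rule Lipschitz_nonincreasing_if_deriv_nonpos_ae[OF M t(2) Lipschitz_differentiable_ae[OF lam]])
    fix r D assume r: "r \<in> {s<..<t} - {x. \<not> lam differentiable at x}" and D: "(energy has_real_derivative D) (at r)"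
    then have diff: "lam differentiable (at r)" by simp
    have yr: "y r \<in> {a..\<beta>}" using r by (intro y) auto
    have "(lam has_real_derivative deriv lam r) (at r)"
      using diff by (simp add: DERIV_deriv_iff_real_differentiable)
    from DERIV_unique[OF D energy_deriv[OF t(1) _ yr this]]
    have "D = f (y r) * (m - deriv lam r) / (f (y r) + m)" using r by auto
    also have "\<dots> \<le> 0"
      using slow[OF diff] f_nonpos[OF yr] denom_pos[OF m(1) yr]
      by (intro divide_nonpos_pos mult_nonpos_nonneg) auto
    finally show "D \<le> 0" .
  qed
qed

text \<open>
  Were the energy equal at both ends, it would be constant in between. But there is a time in between at
  which \<open>lam\<close> is differentiable, and the derivative of the energy is negative at that time.
\<close>

lemma energy_strict_antimono:
  assumes t: "t \<in> I" "s < t" and y: "\<And>r. r \<in> {s..t} \<Longrightarrow> y r \<in> {a<..<\<beta>}"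
  shows "energy t < energy s"
proof (rule ccontr)
  assume "\<not> energy t < energy s"
  then have ge: "energy s \<le> energy t" by simp
  have y': "y r \<in> {a..\<beta>}" if "r \<in> {s..t}" for r using y[OF that] by auto
  have const: "energy r = energy s" if r: "r \<in> {s..t}" for r
  proof -
    have "energy r \<le> energy s" using r by (intro energy_antimono y' I_downward[OF t(1)]) auto
    moreover have "energy t \<le> energy r" using r by (intro energy_antimono y' t(1)) auto
    ultimately show ?thesis using ge by simp
  qed
  have "\<not> {s<..<t} \<subseteq> {x. \<not> lam differentiable (at x)}"
    using negligible_subset[OF Lipschitz_differentiable_ae[OF lam]] open_not_negligible[of "{s<..<t}"] t(2)
    by auto
  then obtain r where r: "r \<in> {s<..<t}" and diff: "lam differentiable (at r)" by blast
  have yr: "y r \<in> {a<..<\<beta>}" using r by (intro y) auto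
  have "(lam has_real_derivative deriv lam r) (at r)"
    using diff by (simp add: DERIV_deriv_iff_real_differentiable)
  from energy_deriv[OF t(1) r _ this] yr
  have "(energy has_real_derivative f (y r) * (m - deriv lam r) / (f (y r) + m)) (at r)" by auto
  moreover have "(energy has_real_derivative 0) (at r)"
  proof (rule has_field_derivative_transform_within_open[where f = "\<lambda>_. energy s" and S = "{s<..<t}"])
    show "energy s = energy u" if "u \<in> {s<..<t}" for u
      by (rule const[symmetric]) (use that in auto)
  qed (use r in auto)
  ultimately have "f (y r) * (m - deriv lam r) / (f (y r) + m) = 0" by (rule DERIV_unique)
  then show False
    using slow[OF diff] f_neg[of "y r"] denom_pos[OF m(1), of "y r"] yr by auto
qed

text \<open>
  As time tends to minus infinity, the energy tends to \<open>travel m a\<close>, its value at \<open>y = a\<close> and \<open>lam = 0\<close>.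
\<close>

lemma energy_le_start:
  assumes s: "s \<in> I" and y: "\<And>r. r \<le> s \<Longrightarrow> y r \<in> {a..\<beta>}"
  shows "energy s \<le> travel m a"
proof (rule tendsto_lowerbound)
  have "isCont (travel m) a"
    using DERIV_isCont[OF travel_deriv[OF m(1)]] a_less by auto
  from isCont_tendsto_compose[OF this start]
  have "((\<lambda>t. travel m (y t) - lam t) \<longlongrightarrow> travel m a - 0) at_bot"
    by (intro tendsto_diff lam_start)
  then show "(energy \<longlongrightarrow> travel m a) at_bot" by (simp add: energy_def[abs_def])
  have "energy s \<le> energy r" if "r \<le> s" for r
    using that by (intro energy_antimono[OF s that] y) auto
  then show "eventually (\<lambda>r. energy s \<le> energy r) at_bot"
    by (rule eventually_mono[OF eventually_le_at_bot])
qed simp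

text \<open>
  At the first arrival at \<open>\<beta>\<close> the energy is \<open>travel m \<beta> - lam \<tau> \<ge> travel m \<beta> - c = travel m a\<close>, at least its limit
  at the start. But it has strictly decreased shortly before, while \<open>y\<close> was strictly between \<open>a\<close> and \<open>\<beta>\<close>.
\<close>

lemma y_less_\<beta>:
  assumes t: "t \<in> I" shows "y t < \<beta>"
proof (rule ccontr)
  assume "\<not> y t < \<beta>"
  have "eventually (\<lambda>s. y s < \<beta>) at_bot" by (rule order_tendstoD(2)[OF start a_less])
  then obtain s0 where s0: "\<And>s. s \<le> s0 \<Longrightarrow> y s < \<beta>" by (auto simp: eventually_at_bot_linorder)
  define A where "A = {s0..t} \<inter> y -` {\<beta>..}"
  have "closed A"
    unfolding A_def by (rule continuous_closed_preimage[OF y_cont[OF t]]) auto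
  moreover have "t \<in> A" using \<open>\<not> y t < \<beta>\<close> s0[of t] by (cases "t \<le> s0") (auto simp: A_def)
  then have "A \<noteq> {}" by blast
  moreover have "bdd_below A" by (auto simp: A_def intro!: bdd_belowI[of _ s0])
  ultimately have "Inf A \<in> A" by (intro closed_contains_Inf)
  define \<tau> where "\<tau> = Inf A"
  have \<tau>: "s0 < \<tau>" "\<tau> \<le> t" "\<beta> \<le> y \<tau>"
    using \<open>Inf A \<in> A\<close> s0[of \<tau>] by (auto simp: A_def \<tau>_def order.strict_iff_order)
  have \<tau>I: "\<tau> \<in> I" by (rule I_downward[OF t \<tau>(2)])
  have before: "y r < \<beta>" if "r < \<tau>" for r
  proof (rule ccontr)
    assume *: "\<not> y r < \<beta>"
    then have "r \<in> A" using that \<tau> s0[of r] by (cases "r \<le> s0") (auto simp: A_def)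
    then show False using cInf_lower[OF _ \<open>bdd_below A\<close>] that by (fastforce simp: \<tau>_def)
  qed
  obtain r where r: "s0 \<le> r" "r \<le> \<tau>" "y r = \<beta>"
    using IVT'[of y s0 \<beta> \<tau>] s0[of s0] \<tau> y_cont[OF \<tau>I, of s0] by auto
  with before[of r] have y\<tau>: "y \<tau> = \<beta>" by (cases "r = \<tau>") auto
  have range: "y r \<in> {a..\<beta>}" if "r \<le> \<tau>" for r
    using y_ge_a[OF I_downward[OF \<tau>I that]] before[of r] y\<tau> that by (cases "r = \<tau>") auto
  have "continuous (at \<tau> within {s0..\<tau>}) y"
    using y_cont[OF \<tau>I, of s0] \<tau> by (auto simp: continuous_on_eq_continuous_within)
  then obtain e where e: "e > 0" "\<And>r. r \<in> {s0..\<tau>} \<Longrightarrow> \<bar>r - \<tau>\<bar> < e \<Longrightarrow> \<bar>y r - y \<tau>\<bar> < \<beta> - a"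
    using continuous_within_eps_delta[THEN iffD1, rule_format, of \<tau> "{s0..\<tau>}" y "\<beta> - a"] a_less
    unfolding dist_real_def by auto
  \<comment> \<open>Shortly before the arrival the solution is in the interior of the well on a whole interval.\<close>
  define s1 s2 where "s1 = max s0 (\<tau> - e / 2)" and "s2 = (s1 + \<tau>) / 2"
  have s: "s0 \<le> s1" "s1 < s2" "s2 < \<tau>" "\<tau> - e < s1" using \<tau> e by (auto simp: s1_def s2_def max_def)
  have "y r \<in> {a<..<\<beta>}" if "r \<in> {s1..s2}" for r
  proof -
    have "\<bar>y r - \<beta>\<bar> < \<beta> - a" using e(2)[of r] that s y\<tau> by auto
    then show ?thesis using before[of r] that s by auto
  qed
  from energy_strict_antimono[OF I_downward[OF \<tau>I] s(2) this] s
  have "energy s2 < energy s1" by auto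
  also have "\<dots> \<le> travel m a"
    using s by (intro energy_le_start I_downward[OF \<tau>I] range) auto
  finally have "energy s2 < travel m a" .
  moreover have "energy \<tau> \<le> energy s2"
    using s by (intro energy_antimono \<tau>I range) auto
  ultimately have "travel m \<beta> - lam \<tau> < travel m a" using y\<tau> by (simp add: energy_def)
  with travel_diff[OF m(1)] m(2) lam_le[of \<tau>] show False by simp
qed

lemma y_range: "t \<in> I \<Longrightarrow> y t \<in> {a..\<beta>}"
  using y_ge_a y_less_\<beta> by (simp add: less_imp_le)

lemma x_antimono:
  assumes "t \<in> I" "s \<le> t" shows "y t - lam t \<le> y s - lam s"
proof -
  have "(y t - lam t) - (y s - lam s) \<le> 0"
    by (rule has_integral_le[OF x_int[OF assms] has_integral_0])
       (use assms in \<open>auto intro!: f_nonpos y_range intro: I_downward\<close>)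
  then show ?thesis by simp
qed

lemma x_bounded_below: "t \<in> I \<Longrightarrow> a - c \<le> y t - lam t"
  using y_ge_a[of t] lam_le[of t] by simp

text \<open>
  The function \<open>x = y - lam\<close> is nonincreasing and bounded below, so \<open>y\<close> converges to some \<open>L\<close>. If \<open>f L\<close> were negative,
  \<open>x\<close> would eventually decrease at least linearly; so \<open>L\<close> is \<open>a\<close> or \<open>\<beta>\<close>. The limit \<open>\<beta>\<close> would bring the
  energy back to its initial value \<open>travel m \<beta> - c = travel m a\<close>, which it has irrevocably left.
\<close>

lemma converges_to_a:
  assumes [simp]: "I = UNIV" shows "(y \<longlongrightarrow> a) at_top"
proof -
  define x where "x t = y t - lam t" for t
  have anti: "x t \<le> x s" if "s \<le> t" for s t using x_antimono[OF _ that] by (simp add: x_def)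
  have bdd: "bdd_below (range x)"
    using x_bounded_below by (auto simp: x_def intro!: bdd_belowI[of _ "a - c"])
  define l where "l = Inf (range x)"
  have l: "(x \<longlongrightarrow> l) at_top"
  proof (rule order_tendstoI)
    fix u assume "u < l"
    then have "u < x t" for t using cInf_lower[OF rangeI bdd, of t] by (simp add: l_def)
    then show "eventually (\<lambda>t. u < x t) at_top" by simp
  next
    fix u assume "l < u"
    then obtain s where s: "x s < u" using cInf_less_iff[OF _ bdd, of u] by (auto simp: l_def)
    show "eventually (\<lambda>t. x t < u) at_top"
      using eventually_ge_at_top[of s] by eventually_elim (use anti s in fastforce)
  qed
  define L where "L = l + c"
  have "((\<lambda>t. x t + lam t) \<longlongrightarrow> L) at_top"
    unfolding L_def by (intro tendsto_add l lam_end)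
  then have L: "(y \<longlongrightarrow> L) at_top" by (simp add: x_def)
  have "a \<le> L" by (rule tendsto_lowerbound[OF L]) (use y_range in auto)
  moreover have "L \<le> \<beta>" by (rule tendsto_upperbound[OF L]) (use y_range in auto)
  ultimately have Lr: "L \<in> {a..\<beta>}" by simp
  have "f L = 0"
  proof (rule ccontr)
    assume "f L \<noteq> 0"
    then have neg: "f L < f L / 2" using f_nonpos[OF Lr] by simp
    have "isCont f L" using f_cont[of UNIV] by (simp add: continuous_on_eq_continuous_at)
    from order_tendstoD(2)[OF isCont_tendsto_compose[OF this L] neg]
    obtain T where T: "\<And>t. T \<le> t \<Longrightarrow> f (y t) < f L / 2" by (auto simp: eventually_at_top_linorder)
    \<comment> \<open>Descending at half the speed of the limit, x would fall below its lower bound within this time.\<close>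
    define h where "h = 2 * (x T - (a - c) + 1) / (- f L)"
    have "x T - (a - c) \<ge> 0" using x_bounded_below[of T] by (simp add: x_def)
    then have h: "h \<ge> 0" "f L / 2 * h = - (x T - (a - c) + 1)"
      using neg by (auto simp: h_def field_simps)
    have "x (T + h) - x T \<le> f L / 2 * h"
    proof (rule has_integral_le)
      show "((\<lambda>r. f (y r)) has_integral x (T + h) - x T) {T..T + h}"
        using x_int[of "T + h" T] h by (simp add: x_def)
      show "((\<lambda>_. f L / 2) has_integral f L / 2 * h) {T..T + h}"
        using has_integral_const_real[of "f L / 2" T "T + h"] h by (simp add: mult.commute)
      show "f (y r) \<le> f L / 2" if "r \<in> {T..T + h}" for r using T[of r] that by auto
    qed
    then have "x (T + h) < a - c" using h(2) by simp
    then show False using x_bounded_below[of "T + h"] by (simp add: x_def)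
  qed
  then have "L = a \<or> L = \<beta>" using f_neg[of L] Lr by fastforce
  moreover have "L \<noteq> \<beta>"
  proof
    assume "L = \<beta>"
    have "eventually (\<lambda>t. a < y t) at_top"
      using order_tendstoD(1)[OF L, of a] \<open>L = \<beta>\<close> a_less by simp
    then obtain T where T: "\<And>t. T \<le> t \<Longrightarrow> a < y t" by (auto simp: eventually_at_top_linorder)
    have "energy (T + 1) < energy T"
      by (rule energy_strict_antimono) (use T y_less_\<beta> in auto)
    also have "\<dots> \<le> travel m a"
      by (rule energy_le_start) (use y_range in auto)
    finally have less: "energy (T + 1) < travel m a" .
    have "isCont (travel m) \<beta>"
      using DERIV_isCont[OF travel_deriv[OF m(1)]] a_less by auto
    from tendsto_diff[OF isCont_tendsto_compose[OF this L[unfolded \<open>L = \<beta>\<close>]] lam_end]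
    have "(energy \<longlongrightarrow> travel m \<beta> - c) at_top" by (simp add: energy_def[abs_def])
    moreover have "eventually (\<lambda>t. energy t \<le> energy (T + 1)) at_top"
      using eventually_ge_at_top[of "T + 1"]
      by eventually_elim (rule energy_antimono, use y_range in auto)
    ultimately have "travel m \<beta> - c \<le> energy (T + 1)"
      by (rule tendsto_upperbound) simp
    with less travel_diff[OF m(1)] m(2) show False by simp
  qed
  ultimately show ?thesis using L by simp
qed

text \<open>
  The function \<open>x = y - lam\<close> is nonincreasing and bounded below, so it has a limit at \<open>b\<close>, which defines the value of
  the extension there. The integrated equation up to \<open>b\<close> then follows from the differential equation in the interior.
\<close>

lemma extension_to_right_endpoint:
  assumes "I = {..<b}"
  shows "\<exists>z. solves_shifted f lam {..b} z \<and> (\<forall>t\<in>I. z t = y t)"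
proof -
  define x where "x t = y t - lam t" for t
  have anti: "x t \<le> x s" if "s \<le> t" "t < b" for s t
    using x_antimono[OF _ that(1)] that assms by (simp add: x_def)
  have bdd: "bdd_below (x ` {..<b})"
    using x_bounded_below assms by (auto simp: x_def intro!: bdd_belowI[of _ "a - c"])
  define l where "l = Inf (x ` {..<b})"
  have below_b: "eventually (\<lambda>t. t < b) (at_left b)" by (auto simp: eventually_at_filter)
  have l: "(x \<longlongrightarrow> l) (at_left b)"
  proof (rule order_tendstoI)
    fix u assume "u < l"
    then have *: "u < x t" if "t < b" for t
      using cInf_lower[OF imageI bdd, of t] that by (simp add: l_def)
    show "eventually (\<lambda>t. u < x t) (at_left b)" using below_b by eventually_elim (rule *)
  next
    fix u assume "l < u"
    then obtain s where s: "s < b" "x s < u" using cInf_less_iff[OF _ bdd, of u] by (auto simp: l_def)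
    have "eventually (\<lambda>t. s < t) (at_left b)" by (rule order_tendstoD(1)[OF tendsto_ident_at s(1)])
    with below_b show "eventually (\<lambda>t. x t < u) (at_left b)"
    proof eventually_elim
      case (elim t)
      then show ?case using anti[of s t] s(2) by simp
    qed
  qed
  define z where "z t = (if t < b then y t else l + lam b)" for t
  have zy: "z t = y t" if "t < b" for t using that by (simp add: z_def)
  have old: "solves_shifted f lam {..<b} z"
    by (rule solves_shifted_cong[OF sol[unfolded assms]]) (auto simp: z_def)
  have z_lim: "(z \<longlongrightarrow> z b) (at_left b)"
  proof -
    have "(lam \<longlongrightarrow> lam b) (at_left b)"
      using lam_cont[of UNIV] continuous_on_eq_continuous_at[OF open_UNIV]
      by (metis UNIV_I continuous_at_imp_continuous_at_within continuous_within)
    with l have "((\<lambda>t. x t + lam t) \<longlongrightarrow> l + lam b) (at_left b)" by (rule tendsto_add)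
    then have "(z \<longlongrightarrow> l + lam b) (at_left b)"
      by (rule Lim_transform_eventually) (use below_b in eventually_elim, simp add: z_def x_def)
    then show ?thesis by (simp add: z_def)
  qed
  have end_cont: "continuous_on {s..b} z" for s
    unfolding continuous_on_eq_continuous_within
  proof
    fix r assume r: "r \<in> {s..b}"
    show "continuous (at r within {s..b}) z"
    proof (cases "r = b")
      case True
      show ?thesis
      proof (cases "s < b")
        case True
        with z_lim have "(z \<longlongrightarrow> z b) (at b within {s..b})" by (simp add: at_within_Icc_at_left)
        with \<open>r = b\<close> show ?thesis by (simp add: continuous_within)
      next
        case False
        with r \<open>r = b\<close> have "{s..b} = {r}" by auto
        then show ?thesis by (simp add: continuous_within tendsto_def eventually_at_filter)
      qed
    next
      case False
      then obtain u where u: "r < u" "u < b" using r dense[of r b] by auto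
      have "continuous_on {r-1..u} z"
        by (rule solves_shiftedD(1)[OF old]) (use u in auto)
      then have "isCont z r" by (rule continuous_on_interior) (use u in auto)
      then show ?thesis by (rule continuous_at_imp_continuous_at_within)
    qed
  qed
  have "solves_shifted f lam {..b} z"
    unfolding solves_shifted_def
  proof (intro ballI impI conjI)
    fix s t assume st: "s \<in> {..b}" "t \<in> {..b}" "s \<le> t"
    show "continuous_on {s..t} z" by (rule continuous_on_subset[OF end_cont[of s]]) (use st in auto)
    then have cont: "continuous_on {s..t} (\<lambda>r. z r - lam r)" by (intro continuous_on_diff lam_cont)
    show "((\<lambda>r. f (z r)) has_integral (z t - lam t) - (z s - lam s)) {s..t}"
    proof (rule fundamental_theorem_of_calculus_interior[OF st(3) cont])
      fix r assume r: "r \<in> {s<..<t}"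
      then obtain u where u: "r < u" "u < b" using st dense[of r b] by auto
      have "((\<lambda>r. z r - lam r) has_real_derivative f (z r)) (at r within {r-1..u})"
        by (rule solves_shifted_deriv[OF f_cont old]) (use u in auto)
      moreover have "at r within {r-1..u} = at r" using u by (intro at_within_interior) auto
      ultimately show "((\<lambda>r. z r - lam r) has_vector_derivative f (z r)) (at r)"
        by (simp add: has_real_derivative_iff_has_vector_derivative)
    qed
  qed
  with zy assms show ?thesis by auto
qed

lemma extension_beyond_endpoint:
  assumes "I = {..b}"
  shows "\<exists>e>b. \<exists>z. solves_shifted f lam {..e} z \<and> (\<forall>t\<in>I. z t = y t)"
proof -
  obtain \<delta> z where z: "\<delta> > 0" "z b = y b" "solves_shifted f lam {b..b + \<delta>} z"
    using local_existence[OF lip lam_cont, of b "y b"] by blast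
  have "solves_shifted f lam {..b + \<delta>} (\<lambda>t. if t \<le> b then y t else z t)"
    using solves_shifted_combine[OF sol[unfolded assms] z(3)] z(2) by simp
  then show ?thesis using z(1) assms by (intro exI[of _ "b + \<delta>"]) auto
qed

text \<open>
  A bounded interval of existence could be enlarged: by its right endpoint if that is missing, and by local
  existence beyond it otherwise.
\<close>

lemma global_if_maximal:
  assumes "maximal_solution f (deriv lam) I y" shows "I = UNIV"
proof (rule ccontr)
  assume "I \<noteq> UNIV"
  then obtain u where "u \<notin> I" by blast
  then have less_u: "t < u" if "t \<in> I" for t using I_downward[OF that, of u] that by force
  have max: "J = I" if "solves_shifted f lam J z" "is_interval J" "I \<subseteq> J" "\<And>t. t \<in> I \<Longrightarrow> z t = y t" for J z
    using assms that caratheodory_iff_solves_shifted[OF f_cont lam] unfolding maximal_solution_def by blast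
  define b where "b = Sup I"
  have bdd: "bdd_above I" using less_u by (auto intro!: bdd_aboveI[of _ u] less_imp_le)
  have ne: "I \<noteq> {}" using low by auto
  have upper: "t \<le> b" if "t \<in> I" for t using cSup_upper[OF that bdd] by (simp add: b_def)
  have inside: "t \<in> I" if "t < b" for t
  proof -
    obtain s where "s \<in> I" "t < s" using less_cSup_iff[OF ne bdd, of t] \<open>t < b\<close> unfolding b_def by blast
    then show ?thesis by (rule I_downward[OF _ less_imp_le])
  qed
  show False
  proof (cases "b \<in> I")
    case True
    then have "t \<in> I \<longleftrightarrow> t \<le> b" for t using upper[of t] inside[of t] by (cases "t = b") auto
    then have "I = {..b}" by auto
    then obtain e z where "e > b" "solves_shifted f lam {..e} z" "\<forall>t\<in>I. z t = y t"
      using extension_beyond_endpoint by blast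
    with max[of "{..e}" z] \<open>I = {..b}\<close> show False by (auto simp: is_interval_ic)
  next
    case False
    then have "t \<in> I \<longleftrightarrow> t < b" for t using upper[of t] inside[of t] by (cases "t = b") auto
    then have "I = {..<b}" by auto
    then obtain z where "solves_shifted f lam {..b} z" "\<forall>t\<in>I. z t = y t"
      using extension_to_right_endpoint by blast
    moreover have "I \<subseteq> {..b}" using upper by auto
    ultimately have "{..b} = I" using max[OF _ is_interval_ic] by blast
    with False show False by auto
  qed
qed

end

section \<open>A ramp at the critical rate tips\<close>

definition ramp :: "real \<Rightarrow> real \<Rightarrow> real \<Rightarrow> real"
  where "ramp m c t = max 0 (min c (m * t))"

lemma ramp_deriv:
  assumes "m > 0" "c > 0"
  shows "t < 0 \<Longrightarrow> (ramp m c has_real_derivative 0) (at t)"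
    and "0 < t \<Longrightarrow> t < c / m \<Longrightarrow> (ramp m c has_real_derivative m) (at t)"
    and "c / m < t \<Longrightarrow> (ramp m c has_real_derivative 0) (at t)"
proof -
  show "(ramp m c has_real_derivative 0) (at t)" if "t < 0"
  proof (rule has_field_derivative_transform_within_open[where f = "\<lambda>_. 0" and S = "{..<0}"])
    show "0 = ramp m c s" if "s \<in> {..<0}" for s
      using mult_pos_neg[OF \<open>m > 0\<close>, of s] that assms by (simp add: ramp_def)
  qed (use that in auto)
  show "(ramp m c has_real_derivative m) (at t)" if "0 < t" "t < c / m"
  proof (rule has_field_derivative_transform_within_open[where f = "\<lambda>s. m * s" and S = "{0<..<c / m}"])
    show "((\<lambda>s. m * s) has_real_derivative m) (at t)" using DERIV_cmult_Id by simp
    show "m * s = ramp m c s" if "s \<in> {0<..<c / m}" for s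
      using that assms by (simp add: ramp_def less_divide_eq mult.commute)
  qed (use that in auto)
  show "(ramp m c has_real_derivative 0) (at t)" if "c / m < t"
  proof (rule has_field_derivative_transform_within_open[where f = "\<lambda>_. c" and S = "{c / m<..}"])
    show "c = ramp m c s" if "s \<in> {c / m<..}" for s
      using that assms by (simp add: ramp_def divide_less_eq mult.commute)
  qed (use that in auto)
qed

lemma ramp_Lipschitz: "m \<ge> 0 \<Longrightarrow> m-lipschitz_on UNIV (ramp m c)"
proof (rule lipschitz_onI)
  fix s t :: real assume "m \<ge> 0"
  have "dist (ramp m c s) (ramp m c t) \<le> \<bar>m * s - m * t\<bar>"
    by (auto simp: ramp_def dist_real_def)
  also have "\<dots> = m * dist s t"
    using \<open>m \<ge> 0\<close> by (simp add: dist_real_def abs_mult flip: right_diff_distrib)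
  finally show "dist (ramp m c s) (ramp m c t) \<le> m * dist s t" .
qed

lemma eventually_const_deriv:
  fixes g :: "real \<Rightarrow> real"
  assumes "\<And>t. t > T \<Longrightarrow> g t = k"
  shows "g C1_differentiable_on {T<..}" and "t > T \<Longrightarrow> deriv g t = 0"
proof -
  have D: "(g has_real_derivative 0) (at t)" if "t > T" for t
    by (rule has_field_derivative_transform_within_open[where f = "\<lambda>_. k" and S = "{T<..}"])
       (use that assms in auto)
  then show "t > T \<Longrightarrow> deriv g t = 0" by (simp add: DERIV_imp_deriv)
  show "g C1_differentiable_on {T<..}"
    unfolding C1_differentiable_on_def
    using D by (intro exI[of _ "\<lambda>_. 0"]) (auto simp: has_real_derivative_iff_has_vector_derivative)
qed

lemma ramp_in_parameter_shifts:
  assumes "m > 0" "c > 0" shows "ramp m c \<in> parameter_shifts c"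
proof -
  have const: "ramp m c t = c" if "c / m < t" for t
    using that assms by (simp add: ramp_def divide_less_eq mult.commute)
  have const': "deriv (ramp m c) t = 0" if "c / m < t" for t
    by (rule eventually_const_deriv(2)[where T = "c / m" and k = c]) (use const that in auto)
  have const'': "deriv (deriv (ramp m c)) t = 0" if "c / m < t" for t
    by (rule eventually_const_deriv(2)[where T = "c / m" and k = 0]) (use const' that in auto)
  have "mono (ramp m c)"
  proof
    fix s t :: real assume "s \<le> t"
    then have "m * s \<le> m * t" using assms by simp
    then show "ramp m c s \<le> ramp m c t" by (auto simp: ramp_def)
  qed
  moreover have "(ramp m c \<longlongrightarrow> 0) at_bot"
  proof (rule tendsto_eventually)
    have "ramp m c t = 0" if "t \<le> 0" for t
      using mult_nonneg_nonpos[of m t] that assms by (simp add: ramp_def)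
    then show "eventually (\<lambda>t. ramp m c t = 0) at_bot"
      by (rule eventually_mono[OF eventually_le_at_bot])
  qed
  moreover have "(ramp m c \<longlongrightarrow> c) at_top"
    by (rule tendsto_eventually, rule eventually_mono[OF eventually_gt_at_top[of "c / m"]]) (simp add: const)
  moreover have "C2_differentiable_on (ramp m c) {c / m<..}"
    unfolding C2_differentiable_on_def
  proof
    show "ramp m c C1_differentiable_on {c / m<..}"
      by (rule eventually_const_deriv(1)[where k = c]) (rule const)
    show "deriv (ramp m c) C1_differentiable_on {c / m<..}"
      by (rule eventually_const_deriv(1)[where k = 0]) (rule const')
  qed
  moreover have "((\<lambda>t. deriv (deriv (ramp m c)) t / exp (- 1 * t)) \<longlongrightarrow> 0) at_top"
    by (rule tendsto_eventually, rule eventually_mono[OF eventually_gt_at_top[of "c / m"]]) (simp add: const'')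
  moreover have "m-lipschitz_on UNIV (ramp m c)"
    using assms by (intro ramp_Lipschitz) simp
  ultimately show ?thesis
    unfolding parameter_shifts_def using zero_less_one by blast
qed

context potential_well
begin

text \<open>
  Before the ramp the solution rests at \<open>a\<close>. Since \<open>travel m\<close> grows by \<open>c\<close> over \<open>[a, \<beta>]\<close>, the time \<open>S x\<close> at which the
  climbing solution passes \<open>x\<close> runs from \<open>0\<close> to \<open>c / m\<close>, the time at which the ramp ends, and the solution is the
  inverse function of \<open>S\<close>. It is then at \<open>\<beta>\<close>, where it can rest.
\<close>

lemma ramp_trajectory:
  assumes m: "\<mu> < m" and c: "passage_shift m = c"
  shows "\<exists>y. solves_shifted f (ramp m c) UNIV y \<and> (\<forall>t\<le>0. y t = a) \<and> (\<forall>t\<ge>c / m. y t = \<beta>)"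
proof -
  have m0: "m > 0" using m \<mu>_pos by simp
  have c0: "c > 0" using passage_shift_gt[OF m] c a_less by simp
  define T where "T = c / m"
  have T: "T > 0" using m0 c0 by (simp add: T_def)
  define S where "S x = (travel m x - travel m a) / m" for x
  have S_deriv: "(S has_real_derivative 1 / (f x + m)) (at x)" if "x \<in> {a..\<beta>}" for x
  proof -
    have "((\<lambda>x. (travel m x - travel m a) / m) has_real_derivative (m / (f x + m) - 0) / m) (at x)"
      by (intro DERIV_cdivide DERIV_diff DERIV_const travel_deriv[OF m that])
    then show ?thesis using m0 by (simp add: S_def[abs_def])
  qed
  have S_cont: "continuous_on {a..\<beta>} S"
    by (rule DERIV_continuous_on, rule has_field_derivative_at_within, rule S_deriv)
  have S_mono: "S u < S v" if "u \<in> {a..\<beta>}" "v \<in> {a..\<beta>}" "u < v" for u v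
  proof (rule DERIV_pos_imp_increasing[OF that(3)])
    fix x assume "u \<le> x" "x \<le> v"
    then have "x \<in> {a..\<beta>}" using that by auto
    then show "\<exists>d. (S has_real_derivative d) (at x) \<and> 0 < d"
      using S_deriv denom_pos[OF m] by (intro exI[of _ "1 / (f x + m)"]) auto
  qed
  have Sa: "S a = 0" by (simp add: S_def)
  have S\<beta>: "S \<beta> = T" using travel_diff[OF m] c by (simp add: S_def T_def)
  have inj: "inj_on S {a..\<beta>}"
    by (rule linorder_inj_onI') (use S_mono in \<open>auto dest: less_imp_neq\<close>)
  have image: "S ` {a..\<beta>} = {0..T}"
  proof
    show "S ` {a..\<beta>} \<subseteq> {0..T}"
    proof safe
      fix x assume x: "x \<in> {a..\<beta>}"
      show "S x \<in> {0..T}"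
        using S_mono[of a x] S_mono[of x \<beta>] x Sa S\<beta> by (cases "x = a"; cases "x = \<beta>") auto
    qed
    show "{0..T} \<subseteq> S ` {a..\<beta>}"
    proof
      fix t assume "t \<in> {0..T}"
      then show "t \<in> S ` {a..\<beta>}"
        using IVT'[of S a t \<beta>] S_cont Sa S\<beta> a_less by auto
    qed
  qed
  define g where "g = the_inv_into {a..\<beta>} S"
  have gS: "g (S x) = x" if "x \<in> {a..\<beta>}" for x
    unfolding g_def using that by (rule the_inv_into_f_f[OF inj])
  have Sg: "S (g t) = t" if "t \<in> {0..T}" for t
    unfolding g_def using that image by (intro f_the_inv_into_f[OF inj]) simp
  have g_range: "g t \<in> {a..\<beta>}" if "t \<in> {0..T}" for t
    unfolding g_def using that image by (intro the_inv_into_into[OF inj]) auto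
  have g0: "g 0 = a" using gS[of a] Sa a_less by simp
  have gT: "g T = \<beta>" using gS[of \<beta>] S\<beta> a_less by simp
  have g_cont: "continuous_on {0..T} g"
    using continuous_on_inv[OF S_cont compact_Icc, of g] gS image by simp
  have g_deriv: "(g has_real_derivative f (g t) + m) (at t)" if t: "0 < t" "t < T" for t
  proof -
    have gt: "g t \<in> {a..\<beta>}" using t by (intro g_range) auto
    have "(g has_real_derivative inverse (1 / (f (g t) + m))) (at t)"
    proof (rule DERIV_inverse_function[where f = S and a = 0 and b = T])
      show "(S has_real_derivative 1 / (f (g t) + m)) (at (g t))" by (rule S_deriv[OF gt])
      show "1 / (f (g t) + m) \<noteq> 0" using denom_pos[OF m gt] by simp
      show "S (g s) = s" if "0 < s" "s < T" for s using that by (intro Sg) auto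
      show "isCont g t" by (rule continuous_on_interior[OF g_cont]) (use t in auto)
    qed (rule t)+
    then show ?thesis by simp
  qed
  define y where "y t = g (max 0 (min T t))" for t
  have y_low: "y t = a" if "t \<le> 0" for t using that T g0 by (simp add: y_def)
  have y_high: "y t = \<beta>" if "t \<ge> T" for t using that T gT by (simp add: y_def)
  have y_cont: "continuous_on S y" for S
    unfolding y_def[abs_def]
    by (rule continuous_on_compose2[OF g_cont continuous_on_max[OF continuous_on_const
            continuous_on_min[OF continuous_on_const continuous_on_id]]])
       (use T in auto)
  have ramp_cont: "continuous_on S (ramp m c)" for S
    using lipschitz_on_continuous_on[OF ramp_Lipschitz[of m c]] m0 continuous_on_subset by fastforce
  have deriv: "((\<lambda>r. y r - ramp m c r) has_real_derivative f (y r)) (at r)" if r: "r \<notin> {0, T}" for r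
  proof -
    consider "r < 0" | "0 < r" "r < T" | "T < r" using r by (auto simp: neq_iff)
    then show ?thesis
    proof cases
      case 1
      have "(y has_real_derivative 0) (at r)"
        by (rule has_field_derivative_transform_within_open[where f = "\<lambda>_. a" and S = "{..<0}"])
           (use 1 y_low in auto)
      from DERIV_diff[OF this ramp_deriv(1)[OF m0 c0 1]] show ?thesis
        using y_low[of r] f_a 1 by simp
    next
      case 2
      have "(y has_real_derivative f (g r) + m) (at r)"
        by (rule has_field_derivative_transform_within_open[where f = g and S = "{0<..<T}"])
           (use 2 g_deriv in \<open>auto simp: y_def\<close>)
      from DERIV_diff[OF this ramp_deriv(2)[OF m0 c0 2(1)]] show ?thesis
        using 2 by (simp add: T_def y_def)
    next
      case 3
      have "(y has_real_derivative 0) (at r)"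
        by (rule has_field_derivative_transform_within_open[where f = "\<lambda>_. \<beta>" and S = "{T<..}"])
           (use 3 y_high in auto)
      from DERIV_diff[OF this ramp_deriv(3)[OF m0 c0]] show ?thesis
        using y_high[of r] f_\<beta> 3 by (simp add: T_def)
    qed
  qed
  have "solves_shifted f (ramp m c) UNIV y"
    unfolding solves_shifted_def
  proof (intro ballI impI conjI y_cont)
    fix s t :: real assume st: "s \<le> t"
    show "((\<lambda>r. f (y r)) has_integral (y t - ramp m c t) - (y s - ramp m c s)) {s..t}"
    proof (rule fundamental_theorem_of_calculus_interior_strong[where S = "{0, T}"])
      show "continuous_on {s..t} (\<lambda>r. y r - ramp m c r)" by (intro continuous_on_diff y_cont ramp_cont)
      show "((\<lambda>r. y r - ramp m c r) has_vector_derivative f (y r)) (at r)" if "r \<in> {s<..<t} - {0, T}" for r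
        using deriv[of r] that by (simp add: has_real_derivative_iff_has_vector_derivative)
    qed (use st in auto)
  qed
  then show ?thesis using y_low y_high by (auto simp: T_def)
qed

text \<open>
  The trajectory is defined on the whole line and hence maximal, but its limit is \<open>\<beta>\<close> instead of \<open>a\<close>.
\<close>

lemma ramp_tips:
  assumes m: "\<mu> < m" and c: "passage_shift m = c"
  shows "induces_tipping f a (ramp m c)"
proof -
  have m0: "m > 0" using m \<mu>_pos by simp
  obtain y where y: "solves_shifted f (ramp m c) UNIV y"
    and low: "\<And>t. t \<le> 0 \<Longrightarrow> y t = a" and high: "\<And>t. t \<ge> c / m \<Longrightarrow> y t = \<beta>"
    using ramp_trajectory[OF assms] by blast
  have "caratheodory_solution f (deriv (ramp m c)) UNIV y"
    using caratheodory_iff_solves_shifted[OF f_cont ramp_Lipschitz] y m0 by (simp add: is_interval_univ)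
  then have "maximal_solution f (deriv (ramp m c)) UNIV y"
    by (simp add: maximal_solution_def top.extremum_unique)
  moreover have "(y \<longlongrightarrow> a) at_bot"
    by (rule tendsto_eventually, rule eventually_mono[OF eventually_le_at_bot[of 0]]) (simp add: low)
  ultimately have "pullback_solution f a (ramp m c) UNIV y"
    by (simp add: pullback_solution_def)
  moreover have "(y \<longlongrightarrow> \<beta>) at_top"
    by (rule tendsto_eventually, rule eventually_mono[OF eventually_ge_at_top[of "c / m"]]) (simp add: high)
  then have "\<not> (y \<longlongrightarrow> a) at_top"
    using tendsto_unique[OF trivial_limit_at_top_linorder] a_less by fastforce
  ultimately show ?thesis unfolding induces_tipping_def by blast
qed

text \<open>
  Otherwise the shift is slower than critical, and its solution would be global and return to \<open>a\<close>.
\<close>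

theorem tipping_needs_critical_rate:
  assumes c: "\<beta> - a < c" and lam: "lam \<in> parameter_shifts c" and tip: "induces_tipping f a lam"
  shows "\<exists>t. lam differentiable (at t) \<and> critical_rate c \<le> deriv lam t"
proof (rule ccontr)
  assume "\<not> ?thesis"
  then have slow: "deriv lam t < critical_rate c" if "lam differentiable (at t)" for t
    using that not_le by blast
  obtain K where K: "K-lipschitz_on UNIV lam" and shift: "mono lam" "(lam \<longlongrightarrow> 0) at_bot" "(lam \<longlongrightarrow> c) at_top"
    using lam unfolding parameter_shifts_def by blast
  obtain I y t0 where maximal: "maximal_solution f (deriv lam) I y" and low: "{..t0} \<subseteq> I" and start: "(y \<longlongrightarrow> a) at_bot"
    and tips: "\<not> ((\<exists>t0. {t0..} \<subseteq> I) \<and> (y \<longlongrightarrow> a) at_top)"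
    using tip unfolding induces_tipping_def pullback_solution_def by blast
  have "is_interval I" "solves_shifted f lam I y"
    using maximal caratheodory_iff_solves_shifted[OF f_cont K] unfolding maximal_solution_def by blast+
  then interpret slow_shift f a \<beta> \<mu> lam K c I y t0
    using K shift c slow low start by unfold_locales
  have "I = UNIV" by (rule global_if_maximal[OF maximal])
  with converges_to_a tips show False by simp
qed

theorem critical_ramp:
  assumes c: "\<beta> - a < c"
  defines "m \<equiv> critical_rate c"
  shows "ramp m c \<in> parameter_shifts c" "induces_tipping f a (ramp m c)"
    "\<exists>t. ramp m c differentiable (at t) \<and> deriv (ramp m c) t = m"
    "ramp m c differentiable (at t) \<Longrightarrow> deriv (ramp m c) t \<le> m"
proof -
  have m: "\<mu> < m" "passage_shift m = c" "0 < m" and c0: "0 < c"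
    using critical_rate[OF c] \<mu>_pos c a_less by (auto simp: m_def)
  show "ramp m c \<in> parameter_shifts c" by (rule ramp_in_parameter_shifts[OF m(3) c0])
  show "induces_tipping f a (ramp m c)" by (rule ramp_tips[OF m(1,2)])
  have half: "x / 2 < x" if "0 < x" for x :: real using that by simp
  have "(ramp m c has_real_derivative m) (at (c / m / 2))"
    by (rule ramp_deriv(2)[OF m(3) c0 half_gt_zero half]) (rule divide_pos_pos[OF c0 m(3)])+
  then show "\<exists>t. ramp m c differentiable (at t) \<and> deriv (ramp m c) t = m"
    using DERIV_imp_deriv real_differentiable_def by blast
  show "deriv (ramp m c) t \<le> m" if "ramp m c differentiable (at t)"
    using Lipschitz_abs_deriv_le[OF ramp_Lipschitz that] m(3) by simp
qed

end

text \<open>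
  A minimum point with value \<open>- \<mu> < 0\<close> differs from both ends of the well, where \<open>f\<close> vanishes, so it is interior and
  the quadratic bound applies to it.
\<close>

lemma potential_well_of_basin:
  fixes f :: "real \<Rightarrow> real" and a \<beta> \<mu> :: real
  assumes f: "C2_differentiable_on f UNIV"
    and "f a = 0" "f \<beta> = 0" and basin: "basin f a = {..<\<beta>}" and "a < \<beta>" and "\<mu> > 0"
    and attained: "\<exists>p\<in>{a..\<beta>}. f p = - \<mu>" and ge: "\<And>x. x \<in> {a..\<beta>} \<Longrightarrow> - \<mu> \<le> f x"
  shows "potential_well f a \<beta> \<mu>"
proof
  show lip: "\<exists>K. K-lipschitz_on {c..d} f" for c d
    using f unfolding C2_differentiable_on_def by (intro C1_imp_locally_Lipschitz) blast
  show "f x < 0" if "a < x" "x < \<beta>" for x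
    using sign_on_basin[OF lip, of x a "-1"] basin that by simp
  show "f x > 0" if "x < a" for x
    using sign_on_basin[OF lip, of x a 1] basin that \<open>a < \<beta>\<close> by simp
  obtain p where p: "p \<in> {a..\<beta>}" "f p = - \<mu>" using attained by blast
  then have "a < p" "p < \<beta>"
    using assms(2,3,6) by (auto simp: order.strict_iff_order)
  with C2_imp_quadratic_bound_at_minimum[OF f this] ge p(2)
  show "\<exists>p\<in>{a<..<\<beta>}. \<exists>C>0. \<forall>x\<in>{a..\<beta>}. f x + \<mu> \<le> C * (x - p)\<^sup>2" by force
qed (use assms in auto)

theorem theorem1:
  fixes f :: "real \<Rightarrow> real" and a \<beta> \<mu> :: real
  assumes "C2_differentiable_on f UNIV"
    and "hyperbolic_rest_point f a" and "attracting_at f a"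
    and "basin f a = {..<\<beta>}"
    and "a < \<beta>"
    and "hyperbolic_rest_point f \<beta>" and "\<not> stable_at f \<beta>"
    and "- \<mu> < 0"
    and "\<exists>p\<in>{a..\<beta>}. f p = - \<mu>" and "\<forall>x\<in>{a..\<beta>}. - \<mu> \<le> f x"
  shows "\<exists>m\<^sub>c :: real \<Rightarrow> real.
    (\<forall>lam_inf > \<beta> - a.
       m\<^sub>c lam_inf > \<mu> \<and>
       (\<forall>lam\<in>parameter_shifts lam_inf. induces_tipping f a lam \<longrightarrow>
          (\<exists>t. lam differentiable (at t) \<and> deriv lam t \<ge> m\<^sub>c lam_inf)) \<and>
       (\<exists>lam\<in>parameter_shifts lam_inf. induces_tipping f a lam \<and>
          (\<exists>t. lam differentiable (at t) \<and> deriv lam t = m\<^sub>c lam_inf) \<and>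
          (\<forall>t. lam differentiable (at t) \<longrightarrow> deriv lam t \<le> m\<^sub>c lam_inf))) \<and>
    continuous_on {\<beta> - a<..} m\<^sub>c \<and>
    strict_antimono_on {\<beta> - a<..} m\<^sub>c \<and>
    filterlim m\<^sub>c at_top (at_right (\<beta> - a)) \<and>
    (m\<^sub>c \<longlongrightarrow> \<mu>) at_top"
proof -
  interpret potential_well f a \<beta> \<mu>
    using assms by (intro potential_well_of_basin) (auto simp: hyperbolic_rest_point_def)
  show ?thesis
  proof (intro exI[of _ critical_rate] conjI allI impI ballI)
    fix c assume c: "\<beta> - a < c"
    show "\<mu> < critical_rate c" by (rule critical_rate(1)[OF c])
    show "\<exists>t. lam differentiable (at t) \<and> critical_rate c \<le> deriv lam t"
      if "lam \<in> parameter_shifts c" "induces_tipping f a lam" for lam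
      by (rule tipping_needs_critical_rate[OF c that])
    show "\<exists>lam\<in>parameter_shifts c. induces_tipping f a lam \<and>
          (\<exists>t. lam differentiable (at t) \<and> deriv lam t = critical_rate c) \<and>
          (\<forall>t. lam differentiable (at t) \<longrightarrow> deriv lam t \<le> critical_rate c)"
      using critical_ramp[OF c] by blast
  qed (rule critical_rate_cont critical_rate_strict_antimono critical_rate_at_small_shift
      critical_rate_at_large_shift)+
qed

end
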